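(* Let $\delta>0$ and let $W:\Omega^2\to[0,1]$ be a graphon. Let $(G_n)_{n\ge n_0}$ (for some $n_0$) be a sequence of simple connected graphs such that $G_n$ has exactly $n$ vertices and minimum degree at least $\delta n$, and such that $\delta_\square(W,G_n)\to0$. Let $t(G_n)$ be the number of spanning trees of $G_n$. Then $$\lim_{n\to\infty}\frac{\sqrt[n]{t(G_n)}}{n}=\exp\left(\int_\Omega\log\bigl(\deg_W(x)\bigr)\,\mathrm dx\right).$$
   Context: $\Omega=[0,1]$ with Lebesgue measure (or any standard atomless probability space). A graphon is a symmetric measurable $W:\Omega^2\to[0,1]$, and $\deg_W(x)=\int_\Omega W(x,y)\,\mathrm dy$. Cut-distance: $\|U\|_\square=\sup_{S,S'\subseteq\Omega}\left|\int_S\int_{S'}U\right|$ over measurable $S,S'$; $\delta_\square(W_1,W_2)=\inf_\varphi\|W_1^\varphi-W_2\|_\square$ over measure preserving automorphisms $\varphi$ of $\Omega$, with $W_1^\varphi(x,y)=W_1(\varphi(x),\varphi(y))$. For an $n$-vertex simple graph $G$, partition $\Omega$ into sets $\Omega_v$ ($v\in V(G)$) of measure $1/n$, let $W_G$ equal $1$ on $\Omega_u\times\Omega_v$ when $uv\in E(G)$ and $0$ otherwise, and set $\delta_\square(W,G)=\delta_\square(W,W_G)$. *)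

theory Defs
  imports "HOL-Analysis.Analysis"
begin

text \<open>A simple graph is given by a vertex set \<open>V\<close> and a set \<open>E\<close> of two-element subsets of \<open>V\<close>.\<close>

definition simple_graph :: "'a set \<Rightarrow> 'a set set \<Rightarrow> bool" where
  "simple_graph V E \<longleftrightarrow> finite V \<and> E \<subseteq> {{u, v} | u v. u \<in> V \<and> v \<in> V \<and> u \<noteq> v}"

definition vertex_degree :: "'a set set \<Rightarrow> 'a \<Rightarrow> nat" where
  "vertex_degree E v = card {e \<in> E. v \<in> e}"

definition connected_graph :: "'a set \<Rightarrow> 'a set set \<Rightarrow> bool" where
  "connected_graph V E \<longleftrightarrow> V \<noteq> {} \<and> (\<forall>u\<in>V. \<forall>v\<in>V. (u, v) \<in> {(x, y). {x, y} \<in> E}\<^sup>*)"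

definition graph_cycle :: "'a set set \<Rightarrow> 'a list \<Rightarrow> bool" where
  "graph_cycle E c \<longleftrightarrow> 3 \<le> length c \<and> distinct c \<and>
     (\<forall>i<length c. {c ! i, c ! (Suc i mod length c)} \<in> E)"

text \<open>A spanning tree has vertex set \<open>V\<close>, so it is identified with its edge set.\<close>

definition spanning_tree :: "'a set \<Rightarrow> 'a set set \<Rightarrow> 'a set set \<Rightarrow> bool" where
  "spanning_tree V E T \<longleftrightarrow> T \<subseteq> E \<and> connected_graph V T \<and> (\<nexists>c. graph_cycle T c)"

definition num_spanning_trees :: "'a set \<Rightarrow> 'a set set \<Rightarrow> nat" where
  "num_spanning_trees V E = card {T. spanning_tree V E T}"

abbreviation unit_space :: "real measure" where
  "unit_space \<equiv> lebesgue_on {0..1}"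

text \<open>
  Measurability of a graphon refers to the Lebesgue sets of the square, which include the
  product of the two Lebesgue \<open>\<sigma>\<close>-algebras. A section \<open>W x\<close> is then measurable for almost
  every \<open>x\<close> only; at the exceptional points the Bochner integral is \<open>0\<close>, which does not affect
  the iterated integrals below. Values of \<open>W\<close> outside the unit square are irrelevant.
\<close>

definition graphon :: "(real \<Rightarrow> real \<Rightarrow> real) \<Rightarrow> bool" where
  "graphon W \<longleftrightarrow>
     (\<lambda>(x, y). W x y) \<in> borel_measurable (lebesgue_on ({0..1} \<times> {0..1})) \<and>
     (\<forall>x\<in>{0..1}. \<forall>y\<in>{0..1}. W x y = W y x \<and> 0 \<le> W x y \<and> W x y \<le> 1)"

definition graphon_degree :: "(real \<Rightarrow> real \<Rightarrow> real) \<Rightarrow> real \<Rightarrow> real" where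
  "graphon_degree W x = (LINT y|unit_space. W x y)"

definition cut_norm :: "(real \<Rightarrow> real \<Rightarrow> real) \<Rightarrow> real" where
  "cut_norm U = (SUP (S, S') \<in> sets unit_space \<times> sets unit_space.
     \<bar>LINT x:S|unit_space. (LINT y:S'|unit_space. U x y)\<bar>)"

definition mp_automorphism :: "(real \<Rightarrow> real) \<Rightarrow> bool" where
  "mp_automorphism \<phi> \<longleftrightarrow>
     bij_betw \<phi> {0..1} {0..1} \<and>
     \<phi> \<in> measurable unit_space unit_space \<and>
     the_inv_into {0..1} \<phi> \<in> measurable unit_space unit_space \<and>
     distr unit_space unit_space \<phi> = unit_space"

definition cut_distance :: "(real \<Rightarrow> real \<Rightarrow> real) \<Rightarrow> (real \<Rightarrow> real \<Rightarrow> real) \<Rightarrow> real" where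
  "cut_distance W\<^sub>1 W\<^sub>2 =
     (INF \<phi> \<in> {\<phi>. mp_automorphism \<phi>}. cut_norm (\<lambda>x y. W\<^sub>1 (\<phi> x) (\<phi> y) - W\<^sub>2 x y))"

definition equipartition :: "'a set \<Rightarrow> ('a \<Rightarrow> real set) \<Rightarrow> bool" where
  "equipartition V P \<longleftrightarrow>
     (\<forall>v\<in>V. P v \<in> sets unit_space \<and> measure unit_space (P v) = 1 / real (card V)) \<and>
     disjoint_family_on P V \<and> (\<Union>v\<in>V. P v) = {0..1}"

text \<open>
  The graphon of a graph, for a given partition \<open>P\<close> of the unit interval indexed by the
  vertices. Its cut-distance to another graphon does not depend on the choice of \<open>P\<close>.
\<close>

definition graph_graphon ::
    "'a set \<Rightarrow> 'a set set \<Rightarrow> ('a \<Rightarrow> real set) \<Rightarrow> real \<Rightarrow> real \<Rightarrow> real" where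
  "graph_graphon V E P x y =
     (if \<exists>u\<in>V. \<exists>v\<in>V. {u, v} \<in> E \<and> x \<in> P u \<and> y \<in> P v then 1 else 0)"

end

theory Submission
  imports Defs "HOL-Combinatorics.Orbits" "HOL-Real_Asymp.Real_Asymp"
begin

text \<open>
  The number of spanning trees is compared with the product of the degrees, up to a factor
  \<open>exp (O ((log n)\<^sup>2))\<close>. Orienting a spanning tree towards a root shows that this product is an upper
  bound. For the lower bound, let every vertex choose one of its neighbours: a uniformly random
  choice function has \<open>O (log n)\<close> cycles on average, since a vertex lies on a cycle of a given
  length with probability at most \<open>1 / (\<delta> n)\<close>. Breaking each cycle leaves a forest, which extends to
  a spanning tree, and the choice function is recovered from this tree and \<open>O (log n)\<close> further edges
  and vertices.

  On the analytic side, testing the cut norm on sets \<open>S \<times> \<Omega>\<close> shows that, after a measure preserving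
  rearrangement, the degree functions converge in \<open>L\<^sup>1\<close>. They are bounded below by \<open>\<delta>\<close>, where the
  logarithm is Lipschitz, so the averages of the logarithms of the degrees converge as well.
\<close>

section \<open>Spanning trees and acyclic edge sets\<close>

definition neighbours :: "'a set set \<Rightarrow> 'a \<Rightarrow> 'a set" where
  "neighbours E v = {u. {v, u} \<in> E}"

abbreviation adjacency :: "'a set set \<Rightarrow> ('a \<times> 'a) set" where
  "adjacency E \<equiv> {(x, y). {x, y} \<in> E}"

lemma sym_adjacency_rtrancl: "sym ((adjacency E)\<^sup>*)"
  by (rule sym_rtrancl) (auto simp: sym_def insert_commute)

lemma simple_graph_edgeD:
  assumes "simple_graph V E" "{u, v} \<in> E"
  shows "u \<in> V" "v \<in> V" "u \<noteq> v"
  using assms by (auto simp: simple_graph_def doubleton_eq_iff dest!: subsetD)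

lemma neighbours_subset: "simple_graph V E \<Longrightarrow> neighbours E v \<subseteq> V"
  by (auto simp: neighbours_def dest: simple_graph_edgeD)

lemma finite_edges:
  assumes "simple_graph V E" shows "finite E"
  using assms by (auto simp: simple_graph_def intro: finite_subset[of _ "Pow V"])

text \<open>A crude bound suffices: it only enters through the base of a power whose exponent is
  \<open>O (log n)\<close>.\<close>

lemma card_edges_le:
  assumes "simple_graph V E" shows "card E \<le> (card V)\<^sup>2"
proof -
  have fin: "finite V" using assms by (simp add: simple_graph_def)
  have "E \<subseteq> (\<lambda>(u, v). {u, v}) ` (V \<times> V)"
    using assms by (auto simp: simple_graph_def image_iff dest!: subsetD)
  hence "card E \<le> card (V \<times> V)"
    using fin by (meson finite_SigmaI surj_card_le)
  thus ?thesis by (simp add: card_cartesian_product power2_eq_square)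
qed

lemma card_neighbours:
  assumes "simple_graph V E"
  shows "card (neighbours E v) = vertex_degree E v"
proof -
  have "bij_betw (\<lambda>u. {v, u}) (neighbours E v) {e \<in> E. v \<in> e}"
  proof (rule bij_betwI')
    fix e assume e: "e \<in> {e \<in> E. v \<in> e}"
    then obtain a b where "e = {a, b}"
      using assms by (auto simp: simple_graph_def dest!: subsetD)
    with e show "\<exists>u\<in>neighbours E v. e = {v, u}"
      by (auto simp: neighbours_def insert_commute)
  qed (auto simp: neighbours_def doubleton_eq_iff)
  thus ?thesis by (simp add: vertex_degree_def bij_betw_same_card)
qed

section \<open>Cycles and simple paths as vertex lists\<close>

text \<open>By distinctness, a path edge can coincide with the closing edge only if the first and
  last entries are consecutive, which forces length two.\<close>

lemma path_avoids_closing_edge: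
  assumes "distinct c" "3 \<le> length c" "\<And>i. Suc i < length c \<Longrightarrow> {c ! i, c ! Suc i} \<in> T"
    and "j < length c"
  shows "(c ! 0, c ! j) \<in> (adjacency (T - {{c ! (length c - 1), c ! 0}}))\<^sup>*"
  using assms(4)
proof (induction j)
  case (Suc j)
  have "{c ! j, c ! Suc j} \<noteq> {c ! (length c - 1), c ! 0}"
  proof
    assume "{c ! j, c ! Suc j} = {c ! (length c - 1), c ! 0}"
    hence "c ! Suc j = c ! 0 \<or> c ! j = c ! 0 \<and> c ! Suc j = c ! (length c - 1)"
      by (auto simp: doubleton_eq_iff)
    moreover have "0 < length c" "j < length c" "length c - 1 < length c" using assms(2) Suc.prems by auto
    ultimately have "j = 0 \<and> Suc j = length c - 1"
      using Suc.prems assms(1) by (auto simp del: One_nat_def simp: nth_eq_iff_index_eq)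
    thus False using assms(2) by linarith
  qed
  moreover have "{c ! j, c ! Suc j} \<in> T" using assms(3) Suc.prems by simp
  ultimately have "(c ! j, c ! Suc j) \<in> adjacency (T - {{c ! (length c - 1), c ! 0}})"
    by simp
  with Suc show ?case by (meson Suc_lessD rtrancl.rtrancl_into_rtrancl)
qed simp

text \<open>Rotating the list by \<open>Suc i\<close> makes the chosen edge the closing one; the
  rest of the cycle then joins its ends.\<close>

lemma graph_cycle_detour:
  assumes "graph_cycle T c" "i < length c"
  shows "(c ! i, c ! (Suc i mod length c)) \<in>
    (adjacency (T - {{c ! i, c ! (Suc i mod length c)}}))\<^sup>*"
proof -
  define d where "d = rotate (Suc i) c"
  have len: "length d = length c" and n3: "3 \<le> length c"
    using assms by (auto simp: d_def graph_cycle_def)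
  have nth: "d ! k = c ! ((Suc i + k) mod length c)" if "k < length c" for k
    using that nth_rotate[of k c "Suc i"] by (simp add: d_def)
  have first: "d ! 0 = c ! (Suc i mod length c)" using nth[of 0] n3
    by (metis add.right_neutral gr0I not_numeral_le_zero)
  have "(Suc i + (length c - 1)) mod length c = (i + length c) mod length c"
    using n3 by (intro arg_cong[of _ _ "\<lambda>x. x mod length c"]) linarith
  also have "\<dots> = i" using assms(2) by simp
  finally have last: "d ! (length c - 1) = c ! i" using nth[of "length c - 1"] n3 by fastforce
  have "{d ! k, d ! Suc k} \<in> T" if "Suc k < length c" for k
  proof -
    let ?m = "(Suc i + k) mod length c"
    have "Suc ?m mod length c = (Suc i + Suc k) mod length c" by (simp add: mod_Suc_eq)
    moreover have "?m < length c" using n3 by (intro mod_less_divisor) linarith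
    ultimately show ?thesis
      using assms(1) that nth[of k] nth[of "Suc k"] unfolding graph_cycle_def
      by (metis Suc_lessD)
  qed
  hence "(d ! 0, d ! (length d - 1)) \<in> (adjacency (T - {{d ! (length d - 1), d ! 0}}))\<^sup>*"
    using assms n3 by (intro path_avoids_closing_edge) (auto simp: len, auto simp: d_def graph_cycle_def)
  hence "(d ! (length d - 1), d ! 0) \<in> (adjacency (T - {{d ! (length d - 1), d ! 0}}))\<^sup>*"
    by (rule symD[OF sym_adjacency_rtrancl])
  thus ?thesis by (simp only: len first last)
qed

text \<open>Every use of the deleted edge is replaced by the detour around it.\<close>

lemma connected_graph_delete_edge:
  assumes "connected_graph V T" "(a, b) \<in> (adjacency (T - {{a, b}}))\<^sup>*"
  shows "connected_graph V (T - {{a, b}})"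
proof -
  have ba: "(b, a) \<in> (adjacency (T - {{a, b}}))\<^sup>*"
    using assms(2) by (rule symD[OF sym_adjacency_rtrancl])
  have "adjacency T \<subseteq> (adjacency (T - {{a, b}}))\<^sup>*"
  proof clarify
    fix x y assume "{x, y} \<in> T"
    thus "(x, y) \<in> (adjacency (T - {{a, b}}))\<^sup>*"
      using assms(2) ba by (cases "{x, y} = {a, b}") (auto simp: doubleton_eq_iff)
  qed
  hence "(adjacency T)\<^sup>* \<subseteq> (adjacency (T - {{a, b}}))\<^sup>*" by (rule rtrancl_subset_rtrancl)
  thus ?thesis using assms(1) by (auto simp: connected_graph_def)
qed

text \<open>Induction along the walk: a new end point that was already visited cuts the path back to
  that visit, any other one is appended.\<close>

lemma simple_path_exists:
  assumes "(a, b) \<in> (adjacency F)\<^sup>*"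
  shows "\<exists>p. p \<noteq> [] \<and> p ! 0 = a \<and> p ! (length p - 1) = b \<and> distinct p \<and>
    (\<forall>i. Suc i < length p \<longrightarrow> {p ! i, p ! Suc i} \<in> F)"
  using assms
proof (induction rule: rtrancl_induct)
  case base
  show ?case by (rule exI[of _ "[a]"]) simp
next
  case (step y z)
  then obtain p where p: "p \<noteq> []" "p ! 0 = a" "p ! (length p - 1) = y" "distinct p"
    "\<And>i. Suc i < length p \<Longrightarrow> {p ! i, p ! Suc i} \<in> F" by auto
  show ?case
  proof (cases "z \<in> set p")
    case True
    then obtain k where k: "k < length p" "p ! k = z" by (auto simp: in_set_conv_nth)
    show ?thesis
      using p k by (intro exI[of _ "take (Suc k) p"]) (auto simp: min_absorb2)
  next
    case False
    have "{(p @ [z]) ! i, (p @ [z]) ! Suc i} \<in> F" if "i < length p" for i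
    proof (cases "Suc i = length p")
      case True
      hence "i = length p - 1" by simp
      thus ?thesis using p(1,3) step(2) by (simp add: nth_append)
    next
      case False
      thus ?thesis using p(5)[of i] that by (simp add: nth_append)
    qed
    thus ?thesis
      using p False by (intro exI[of _ "p @ [z]"]) (auto simp: nth_append)
  qed
qed

text \<open>A simple path from \<open>a\<close> to \<open>b\<close> has at least three vertices:
  \<open>a \<noteq> b\<close> excludes one, and two would put the edge \<open>{a, b}\<close> into
  \<open>F\<close>.\<close>

lemma path_closes_to_cycle:
  assumes "(a, b) \<in> (adjacency F)\<^sup>*" "{a, b} \<notin> F" "a \<noteq> b"
  shows "\<exists>c. graph_cycle (insert {a, b} F) c"
proof -
  obtain p where p: "p \<noteq> []" "p ! 0 = a" "p ! (length p - 1) = b" "distinct p"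
    "\<And>i. Suc i < length p \<Longrightarrow> {p ! i, p ! Suc i} \<in> F"
    using simple_path_exists[OF assms(1)] by auto
  have "length p \<noteq> 0" "length p \<noteq> 1" using p assms(3) by auto
  moreover have "length p \<noteq> 2" using p(5)[of 0] p(2,3) assms(2) by auto
  ultimately have "3 \<le> length p" by linarith
  moreover have "{p ! i, p ! (Suc i mod length p)} \<in> insert {a, b} F" if "i < length p" for i
  proof (cases "Suc i = length p")
    case True
    hence "i = length p - 1" by simp
    thus ?thesis using p(1,2,3) by auto
  next
    case False
    thus ?thesis using p(5)[of i] that by simp
  qed
  ultimately show ?thesis using p(4) by (auto simp: graph_cycle_def)
qed

section \<open>Orienting a spanning tree towards a root\<close>

text \<open>An edge of \<open>T\<close> outside \<open>F\<close> would close a cycle with a path in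
  \<open>F\<close> between its ends.\<close>

lemma spanning_tree_minimal:
  assumes "simple_graph V E" "spanning_tree V E T" "F \<subseteq> T" "connected_graph V F"
  shows "F = T"
proof (rule ccontr)
  assume "F \<noteq> T"
  then obtain e where e: "e \<in> T" "e \<notin> F" using assms(3) by blast
  with assms(1,2) obtain a b where ab: "e = {a, b}" "a \<in> V" "b \<in> V" "a \<noteq> b"
    unfolding simple_graph_def spanning_tree_def by blast
  have "(a, b) \<in> (adjacency F)\<^sup>*" using ab assms(4) by (auto simp: connected_graph_def)
  then obtain c where "graph_cycle (insert e F) c"
    using path_closes_to_cycle ab e by metis
  hence "graph_cycle T c" using assms(3) e(1) by (auto simp: graph_cycle_def)
  thus False using assms(2) by (auto simp: spanning_tree_def)
qed

text \<open>The parent of \<open>v\<close> is a neighbour in \<open>T\<close> that is closer to the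
  root. The parent edges already connect \<open>V\<close>, so by minimality they are all of
  \<open>T\<close>.\<close>

lemma spanning_tree_parent:
  assumes "simple_graph V E" "spanning_tree V E T" "r \<in> V"
  shows "\<exists>p \<in> Pi\<^sub>E (V - {r}) (neighbours E). T = (\<lambda>v. {v, p v}) ` (V - {r})"
proof -
  let ?A = "adjacency T"
  define h where "h v = (LEAST k. (v, r) \<in> ?A ^^ k)" for v
  have TE: "T \<subseteq> E" and con: "connected_graph V T" using assms(2) by (auto simp: spanning_tree_def)
  have reach: "(v, r) \<in> ?A ^^ h v" if "v \<in> V" for v
  proof -
    have "(v, r) \<in> ?A\<^sup>*" using con that assms(3) by (auto simp: connected_graph_def)
    thus ?thesis unfolding h_def by (auto simp: rtrancl_power intro: LeastI)
  qed
  have "\<exists>w. {v, w} \<in> T \<and> h w < h v" if v: "v \<in> V - {r}" for v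
  proof -
    have "h v \<noteq> 0" using reach[of v] v by (auto intro: gr0I)
    then obtain m where m: "h v = Suc m" using not0_implies_Suc by blast
    with reach[of v] v obtain w where "(v, w) \<in> ?A" "(w, r) \<in> ?A ^^ m"
      using relpow_Suc_D2[of v r m ?A] by auto
    thus ?thesis using m by (auto simp: h_def intro!: exI[of _ w] le_imp_less_Suc Least_le)
  qed
  then obtain p0 where p0: "\<And>v. v \<in> V - {r} \<Longrightarrow> {v, p0 v} \<in> T \<and> h (p0 v) < h v" by metis
  define p where "p = restrict p0 (V - {r})"
  define F where "F = (\<lambda>v. {v, p v}) ` (V - {r})"
  have p: "{v, p v} \<in> T" "h (p v) < h v" if "v \<in> V - {r}" for v
    using p0[OF that] that by (auto simp: p_def)
  have toroot: "(v, r) \<in> (adjacency F)\<^sup>*" if "v \<in> V" for v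
    using that
  proof (induction "h v" arbitrary: v rule: less_induct)
    case less
    show ?case
    proof (cases "v = r")
      case False
      hence v: "v \<in> V - {r}" using less by simp
      have "p v \<in> V" using p(1)[OF v] TE simple_graph_edgeD(2)[OF assms(1)] by blast
      hence "(p v, r) \<in> (adjacency F)\<^sup>*" using less p(2)[OF v] by blast
      moreover have "(v, p v) \<in> adjacency F" using v by (auto simp: F_def)
      ultimately show ?thesis by (meson converse_rtrancl_into_rtrancl)
    qed simp
  qed
  have "connected_graph V F" unfolding connected_graph_def
  proof (intro conjI ballI)
    show "V \<noteq> {}" using assms(3) by auto
    fix u v assume "u \<in> V" "v \<in> V"
    thus "(u, v) \<in> (adjacency F)\<^sup>*"
      using toroot sym_adjacency_rtrancl[of F] by (meson rtrancl_trans symD)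
  qed
  moreover have "F \<subseteq> T" using p(1) by (auto simp: F_def)
  ultimately have "F = T" using spanning_tree_minimal[OF assms(1,2)] by blast
  moreover have "p \<in> Pi\<^sub>E (V - {r}) (neighbours E)"
  proof (rule PiE_I)
    show "p v \<in> neighbours E v" if "v \<in> V - {r}" for v
      using p(1)[OF that] TE by (auto simp: neighbours_def)
  qed (auto simp: p_def)
  ultimately show ?thesis by (auto simp: F_def)
qed

lemma card_spanning_tree_le:
  assumes "simple_graph V E" "spanning_tree V E T"
  shows "card T \<le> card V - 1"
proof -
  obtain r where r: "r \<in> V" using assms(2) by (auto simp: spanning_tree_def connected_graph_def)
  have fin: "finite V" using assms(1) by (simp add: simple_graph_def)
  obtain p where "T = (\<lambda>v. {v, p v}) ` (V - {r})" using spanning_tree_parent[OF assms r] by auto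
  thus ?thesis using fin r by (metis card_Diff_singleton card_image_le finite_Diff)
qed

lemma finite_spanning_trees:
  assumes "simple_graph V E" shows "finite {T. spanning_tree V E T}"
  using finite_edges[OF assms] by (auto simp: spanning_tree_def intro: finite_subset[of _ "Pow E"])

text \<open>A tree is recovered from its parent function, which chooses a neighbour for every vertex
  but the root.\<close>

lemma num_spanning_trees_le:
  assumes "simple_graph V E" "connected_graph V E" "\<And>v. v \<in> V \<Longrightarrow> vertex_degree E v > 0"
  shows "num_spanning_trees V E \<le> (\<Prod>v\<in>V. vertex_degree E v)"
proof -
  obtain r where r: "r \<in> V" using assms(2) by (auto simp: connected_graph_def)
  have fin: "finite V" using assms(1) by (simp add: simple_graph_def)
  have "{T. spanning_tree V E T} \<subseteq>
      (\<lambda>p. (\<lambda>v. {v, p v}) ` (V - {r})) ` Pi\<^sub>E (V - {r}) (neighbours E)"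
    using spanning_tree_parent[OF assms(1) _ r] by (auto simp: image_iff)
  moreover have "finite (Pi\<^sub>E (V - {r}) (neighbours E))"
    using fin neighbours_subset[OF assms(1)] by (intro finite_PiE) (auto intro: finite_subset)
  ultimately have "num_spanning_trees V E \<le> card (Pi\<^sub>E (V - {r}) (neighbours E))"
    unfolding num_spanning_trees_def by (rule surj_card_le[rotated])
  also have "\<dots> = (\<Prod>v\<in>V - {r}. vertex_degree E v)"
    using fin by (simp add: card_PiE card_neighbours[OF assms(1)])
  \<comment> \<open>The missing factor of the root is at least one.\<close>
  also have "\<dots> \<le> (\<Prod>v\<in>V. vertex_degree E v)"
    using assms(3)[OF r] by (simp add: prod.remove[OF fin r])
  finally show ?thesis .
qed

section \<open>Maps that decrease a height\<close>

text \<open>Both cycle edges at a vertex \<open>v\<close> of maximal height must come from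
  \<open>v\<close> itself, since otherwise the other end would be higher. Both neighbours of
  \<open>v\<close> on the cycle then equal \<open>f v\<close>, which contradicts
  distinctness.\<close>

lemma descending_map_acyclic:
  fixes h :: "'a \<Rightarrow> nat"
  assumes desc: "\<And>v. v \<in> A \<Longrightarrow> h (f v) < h v"
  shows "\<not> graph_cycle ((\<lambda>v. {v, f v}) ` A) c"
proof
  assume c: "graph_cycle ((\<lambda>v. {v, f v}) ` A) c"
  let ?n = "length c"
  have n3: "3 \<le> ?n" and dis: "distinct c" using c by (auto simp: graph_cycle_def)
  have "\<exists>i. i < ?n \<and> (\<forall>j<?n. h (c ! j) \<le> h (c ! i))"
    using n3 ex_has_greatest_nat[of "\<lambda>i. i < ?n" 0 "\<lambda>i. h (c ! i)" "Max (h ` set c) + 1"]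
    by (force simp: less_Suc_eq_le)
  then obtain i where i: "i < ?n" and max: "\<And>j. j < ?n \<Longrightarrow> h (c ! j) \<le> h (c ! i)" by auto
  have up: "c ! j = f (c ! i)" if edge: "{c ! i, c ! j} \<in> (\<lambda>v. {v, f v}) ` A" and j: "j < ?n" for j
  proof -
    obtain v where v: "v \<in> A" "{c ! i, c ! j} = {v, f v}" using edge by blast
    show ?thesis
    proof (cases "v = c ! i")
      case False
      hence "v = c ! j" "f v = c ! i" using v(2) by (auto simp: doubleton_eq_iff)
      thus ?thesis using desc[OF v(1)] max[OF j] by simp
    qed (use v in \<open>auto simp: doubleton_eq_iff\<close>)
  qed
  \<comment> \<open>Cyclic predecessor of \<open>i\<close>; adding \<open>?n\<close> first keeps the
    subtraction from truncating at \<open>i = 0\<close>.\<close>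
  define k where "k = (i + ?n - 1) mod ?n"
  have k: "k < ?n" using n3 unfolding k_def by (intro mod_less_divisor) linarith
  have "Suc k mod ?n = Suc (i + ?n - 1) mod ?n" by (simp add: k_def mod_Suc_eq)
  also have "Suc (i + ?n - 1) = i + ?n" using n3 by linarith
  finally have ki: "Suc k mod ?n = i" using i by simp
  have s: "Suc i mod ?n < ?n" using n3 by (intro mod_less_divisor) linarith
  have "c ! k = f (c ! i)" using c k ki by (intro up) (auto simp: graph_cycle_def insert_commute)
  moreover have "c ! (Suc i mod ?n) = f (c ! i)"
    using c i s by (intro up) (auto simp: graph_cycle_def)
  ultimately have "Suc i mod ?n = k" using dis k s by (metis nth_eq_iff_index_eq)
  \<comment> \<open>With at least three entries, successor and predecessor of \<open>i\<close>
    differ.\<close>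
  thus False using ki i n3 by (auto simp: mod_Suc split: if_splits)
qed

text \<open>Induction on the height. If \<open>{v, f v}\<close> arises under \<open>g\<close> from
  another vertex \<open>u\<close>, then \<open>u = f v\<close> is lower, so
  \<open>f u = g u = v\<close> by induction, and \<open>h v < h u < h v\<close> follows.\<close>

lemma descending_map_edges_inj:
  fixes h :: "'a \<Rightarrow> nat"
  assumes desc: "\<And>v. v \<in> A \<Longrightarrow> h (f v) < h v"
    and edges: "(\<lambda>v. {v, f v}) ` A = (\<lambda>v. {v, g v}) ` A"
    and "v \<in> A"
  shows "f v = g v"
  using assms(3)
proof (induction "h v" arbitrary: v rule: less_induct)
  case less
  have "{v, f v} \<in> (\<lambda>v. {v, g v}) ` A" using less(2) edges by blast
  then obtain u where u: "u \<in> A" "{v, f v} = {u, g u}" by auto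
  show ?case
  proof (cases "u = v")
    case False
    hence uv: "u = f v" "g u = v" using u(2) by (auto simp: doubleton_eq_iff)
    have hu: "h u < h v" using desc[OF less(2)] uv by simp
    have "f u = v" using less(1)[OF hu u(1)] uv by simp
    thus ?thesis using desc[OF u(1)] hu by simp
  qed (use u in \<open>auto simp: doubleton_eq_iff\<close>)
qed

lemma descending_map_edge_inj_on:
  fixes h :: "'a \<Rightarrow> nat"
  assumes desc: "\<And>v. v \<in> A \<Longrightarrow> h (f v) < h v"
  shows "inj_on (\<lambda>v. {v, f v}) A"
proof (rule inj_onI)
  fix u v assume "u \<in> A" "v \<in> A" "{u, f u} = {v, f v}"
  thus "u = v" using desc[of u] desc[of v] by (auto simp: doubleton_eq_iff)
qed

text \<open>Among the connected edge sets between \<open>F\<close> and \<open>E\<close>, one with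
  fewest edges has no cycle: a cycle would have an edge outside the acyclic \<open>F\<close>, and
  deleting it keeps the set connected.\<close>

lemma acyclic_extends_to_spanning_tree:
  assumes "simple_graph V E" "connected_graph V E" "F \<subseteq> E" "\<nexists>c. graph_cycle F c"
  shows "\<exists>T. spanning_tree V E T \<and> F \<subseteq> T"
proof -
  let ?P = "\<lambda>T. F \<subseteq> T \<and> T \<subseteq> E \<and> connected_graph V T"
  obtain T where T: "?P T" and min: "\<And>T'. ?P T' \<Longrightarrow> card T \<le> card T'"
    using ex_has_least_nat[of ?P E card] assms(2,3) by blast
  have "\<not> graph_cycle T c" for c
  proof
    assume c: "graph_cycle T c"
    have "\<not> graph_cycle F c" using assms(4) by blast
    then obtain i where i: "i < length c" "{c ! i, c ! (Suc i mod length c)} \<notin> F"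
      using c by (auto simp: graph_cycle_def)
    let ?e = "{c ! i, c ! (Suc i mod length c)}"
    have eT: "?e \<in> T" using c i by (auto simp: graph_cycle_def)
    have "connected_graph V (T - {?e})"
      using connected_graph_delete_edge[OF _ graph_cycle_detour[OF c i(1)]] T by blast
    hence "card T \<le> card (T - {?e})" using T i by (intro min) blast
    moreover have "finite T" using T finite_edges[OF assms(1)] finite_subset by blast
    ultimately show False using eT by (metis card_Diff1_less leD)
  qed
  thus ?thesis using T by (auto simp: spanning_tree_def)
qed

section \<open>Cycles of random choice functions\<close>

text \<open>\<open>orbit f v\<close> consists of the iterates of \<open>v\<close> with positive
  exponent, so \<open>v \<in> orbit f v\<close> says that \<open>v\<close> is periodic.\<close>

definition cycles :: "'a set \<Rightarrow> ('a \<Rightarrow> 'a) \<Rightarrow> 'a set set" where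
  "cycles V f = {orbit f v | v. v \<in> V \<and> v \<in> orbit f v}"

lemma orbit_subset_carrier:
  assumes "f \<in> V \<rightarrow> V" "v \<in> V" shows "orbit f v \<subseteq> V"
proof
  fix y assume "y \<in> orbit f v"
  thus "y \<in> V" using assms by induction auto
qed

lemma orbit_eq_of_mem_cycle:
  assumes "v \<in> orbit f v" "u \<in> orbit f v" shows "orbit f u = orbit f v"
  using cyclic_on_singleI[OF assms(1) refl] assms(2) by (rule orbit_cyclic_eq3)

lemma funpow_carrier: "f \<in> V \<rightarrow> V \<Longrightarrow> v \<in> V \<Longrightarrow> (f ^^ k) v \<in> V"
  by (induction k) auto

text \<open>Pigeonhole: the iterates of \<open>v\<close> stay in a finite set, so two of them
  coincide.\<close>

lemma eventually_cyclic:
  assumes "finite V" "f \<in> V \<rightarrow> V" "v \<in> V"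
  shows "\<exists>k. (f ^^ k) v \<in> orbit f ((f ^^ k) v)"
proof -
  have "\<not> inj_on (\<lambda>k. (f ^^ k) v) UNIV"
  proof
    assume "inj_on (\<lambda>k. (f ^^ k) v) UNIV"
    moreover have "range (\<lambda>k. (f ^^ k) v) \<subseteq> V" using funpow_carrier[OF assms(2,3)] by auto
    ultimately have "finite (UNIV :: nat set)" using assms(1) by (rule inj_on_finite)
    thus False by simp
  qed
  then obtain i j :: nat where ij: "(f ^^ i) v = (f ^^ j) v" "i < j"
    unfolding inj_on_def by (metis linorder_neqE_nat)
  have "(f ^^ (j - i)) ((f ^^ i) v) = (f ^^ (j - i + i)) v" by (simp only: funpow_add o_apply)
  also have "\<dots> = (f ^^ i) v" using ij by simp
  finally have "(f ^^ i) v \<in> orbit f ((f ^^ i) v)"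
    using ij(2) unfolding orbit_altdef by (auto intro!: exI[of _ "j - i"])
  thus ?thesis ..
qed

text \<open>\<open>R\<close> takes one vertex from each cycle. Every trajectory enters a cycle and
  from then on meets all of its vertices.\<close>

lemma cycle_representatives:
  assumes "finite V" "f \<in> V \<rightarrow> V"
  shows "\<exists>R\<subseteq>V. card R \<le> card (cycles V f) \<and> (\<forall>v\<in>V. \<exists>k. (f ^^ k) v \<in> R)"
proof -
  define R where "R = (\<lambda>C. SOME u. u \<in> C) ` cycles V f"
  have rep: "(SOME u. u \<in> orbit f v) \<in> orbit f v" for v
    using orbit_nonempty[of f v] by (simp add: some_in_eq)
  have fin: "finite (cycles V f)"
    using assms(1) by (auto simp: cycles_def)
  show ?thesis
  proof (intro exI[of _ R] conjI ballI)
    show "R \<subseteq> V"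
    proof
      fix u assume "u \<in> R"
      then obtain v where v: "v \<in> V" "u = (SOME u. u \<in> orbit f v)"
        by (auto simp: R_def cycles_def)
      show "u \<in> V" using rep[of v] orbit_subset_carrier[OF assms(2) v(1)] unfolding v(2) by blast
    qed
    show "card R \<le> card (cycles V f)" unfolding R_def using fin by (rule card_image_le)
    fix v assume v: "v \<in> V"
    obtain k where k: "(f ^^ k) v \<in> orbit f ((f ^^ k) v)"
      using eventually_cyclic[OF assms v] ..
    let ?u = "SOME u. u \<in> orbit f ((f ^^ k) v)"
    have "orbit f ((f ^^ k) v) \<in> cycles V f"
      using k funpow_carrier[OF assms(2) v, of k] unfolding cycles_def by blast
    hence "?u \<in> R" unfolding R_def by (rule imageI)
    moreover obtain m where "?u = (f ^^ m) ((f ^^ k) v)"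
      using rep[of "(f ^^ k) v"] unfolding orbit_altdef[of f "(f ^^ k) v"] by blast
    ultimately show "\<exists>k. (f ^^ k) v \<in> R"
      by (intro exI[of _ "m + k"]) (simp add: funpow_add)
  qed
qed

text \<open>Each vertex of a cycle of length \<open>l\<close> has weight \<open>1 / l\<close>, so
  each cycle has total weight one. Splitting by the length prepares a separate estimate for every
  pair \<open>(v, l)\<close>.\<close>

lemma card_cycles_eq:
  assumes "finite V" "f \<in> V \<rightarrow> V"
  shows "real (card (cycles V f)) =
    (\<Sum>v\<in>V. \<Sum>l=1..card V. if v \<in> orbit f v \<and> card (orbit f v) = l then 1 / real l else 0)"
proof -
  have fin: "finite C" "C \<noteq> {}" "C \<subseteq> V" if C: "C \<in> cycles V f" for C
  proof -
    obtain v where v: "v \<in> V" "v \<in> orbit f v" "C = orbit f v" using C by (auto simp: cycles_def)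
    show "finite C" "C \<noteq> {}" "C \<subseteq> V"
      using v orbit_subset_carrier[OF assms(2) v(1)] assms(1) by (auto intro: finite_subset)
  qed
  have orb: "orbit f v = C" "v \<in> orbit f v" if C: "C \<in> cycles V f" "v \<in> C" for C v
  proof -
    obtain u where u: "u \<in> orbit f u" "C = orbit f u" using C(1) by (auto simp: cycles_def)
    show "orbit f v = C" using orbit_eq_of_mem_cycle[OF u(1)] C(2) u(2) by simp
    thus "v \<in> orbit f v" using C(2) by simp
  qed
  have disj: "\<forall>A\<in>cycles V f. \<forall>B\<in>cycles V f. A \<noteq> B \<longrightarrow> A \<inter> B = {}"
    using orb(1) by blast
  have un: "\<Union> (cycles V f) = {v \<in> V. v \<in> orbit f v}"
  proof (intro equalityI subsetI)
    show "v \<in> {v \<in> V. v \<in> orbit f v}" if "v \<in> \<Union> (cycles V f)" for v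
      using that fin(3) orb(2) by blast
    show "v \<in> \<Union> (cycles V f)" if "v \<in> {v \<in> V. v \<in> orbit f v}" for v
      using that unfolding cycles_def by blast
  qed
  have inner: "(\<Sum>v\<in>C. 1 / real (card (orbit f v))) = 1" if "C \<in> cycles V f" for C
  proof -
    have "(\<Sum>v\<in>C. 1 / real (card (orbit f v))) = (\<Sum>v\<in>C. 1 / real (card C))"
      using orb(1)[OF that] by (intro sum.cong) auto
    also have "\<dots> = 1" using fin[OF that] by (simp add: card_eq_0_iff)
    finally show ?thesis .
  qed
  have "real (card (cycles V f)) = (\<Sum>C\<in>cycles V f. \<Sum>v\<in>C. 1 / real (card (orbit f v)))"
    using inner by simp
  also have "\<dots> = (\<Sum>v\<in>\<Union> (cycles V f). 1 / real (card (orbit f v)))"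
    using fin(1) disj by (subst sum.Union_disjoint) auto
  also have "\<dots> = (\<Sum>v\<in>V. if v \<in> orbit f v then 1 / real (card (orbit f v)) else 0)"
    unfolding un using assms(1) by (intro sum.inter_filter)
  also have "\<dots> = (\<Sum>v\<in>V. \<Sum>l=1..card V.
      if v \<in> orbit f v \<and> card (orbit f v) = l then 1 / real l else 0)"
  proof (rule sum.cong[OF refl])
    fix v assume v: "v \<in> V"
    have sub: "orbit f v \<subseteq> V" using orbit_subset_carrier[OF assms(2) v] .
    have "card (orbit f v) \<in> {1..card V}"
      using sub assms(1) orbit_nonempty[of f v]
      by (auto simp: card_mono Suc_le_eq card_gt_0_iff intro: finite_subset)
    thus "(if v \<in> orbit f v then 1 / real (card (orbit f v)) else 0) =
      (\<Sum>l=1..card V. if v \<in> orbit f v \<and> card (orbit f v) = l then 1 / real l else 0)"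
      by (cases "v \<in> orbit f v") (simp_all add: sum.delta')
  qed
  finally show ?thesis .
qed

section \<open>The average number of cycles\<close>

text \<open>The size of a periodic orbit is its first return time \<open>funpow_dist1 f v v\<close>,
  and the iterates before that time are distinct.\<close>

lemma orbit_period:
  assumes "v \<in> orbit f v" "card (orbit f v) = Suc m"
  shows "(f ^^ Suc m) v = v" "inj_on (\<lambda>i. (f ^^ i) v) {..m}"
proof -
  have "card (orbit f v) = funpow_dist1 f v v"
    using orbit_conv_funpow_dist1[OF assms(1)] inj_on_funpow_dist1[OF assms(1)]
    by (metis card_atLeastLessThan card_image diff_zero)
  hence m: "funpow_dist1 f v v = Suc m" using assms(2) by simp
  show "(f ^^ Suc m) v = v" using funpow_dist1_prop[OF assms(1)] m by metis
  show "inj_on (\<lambda>i. (f ^^ i) v) {..m}"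
    using inj_on_funpow_dist1[OF assms(1)] m
    by (simp add: atLeast0LessThan lessThan_Suc_atMost)
qed

text \<open>
  Redirecting the last vertex \<open>u = f\<^sup>m v\<close> of a cycle through \<open>v\<close> to an arbitrary neighbour of \<open>u\<close>
  is reversible, because the path from \<open>v\<close> to \<open>u\<close> does not use the value at \<open>u\<close>.
\<close>

lemma card_period_le:
  fixes d :: real
  assumes "finite V" "v \<in> V" "\<And>u. u \<in> V \<Longrightarrow> finite (N u) \<and> N u \<subseteq> V \<and> d \<le> real (card (N u))"
  defines "\<F> \<equiv> Pi\<^sub>E V N"
  shows "d * real (card {f \<in> \<F>. v \<in> orbit f v \<and> card (orbit f v) = Suc m}) \<le> real (card \<F>)"
proof -
  let ?A = "{f \<in> \<F>. v \<in> orbit f v \<and> card (orbit f v) = Suc m}"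
  define u where "u f = (f ^^ m) v" for f :: "'a \<Rightarrow> 'a"
  \<comment> \<open>Pairs of a function and a new target for its vertex \<open>u f\<close>; each
    function has at least \<open>d\<close> targets.\<close>
  define S where "S = (SIGMA f:?A. N (u f))"
  have finF: "finite \<F>" unfolding \<F>_def using assms(1,3) by (intro finite_PiE) auto
  have FV: "f \<in> V \<rightarrow> V" if "f \<in> \<F>" for f using that assms(3) by (auto simp: \<F>_def PiE_def Pi_def)
  have uV: "u f \<in> V" if "f \<in> \<F>" for f
    unfolding u_def using funpow_carrier[OF FV[OF that] assms(2)] .
  have redirect: "(f(u f := w) ^^ i) v = (f ^^ i) v" if "f \<in> ?A" "i \<le> m" for f w i
    using that(2)
  proof (induction i)
    case (Suc i)
    have "inj_on (\<lambda>i. (f ^^ i) v) {..m}" using orbit_period(2) that(1) by fast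
    hence "(f ^^ i) v \<noteq> u f" using Suc.prems by (auto simp: u_def dest: inj_onD)
    thus ?case using Suc by simp
  qed simp
  \<comment> \<open>The value overwritten at \<open>u f\<close> is always \<open>v\<close>, so the
    redirection loses nothing.\<close>
  have close: "f (u f) = v" if "f \<in> ?A" for f
    using orbit_period(1)[of v f m] that by (simp add: u_def)
  have inj: "inj_on (\<lambda>(f, w). f(u f := w)) S"
  proof (rule inj_onI, clarify)
    fix f w g z assume S: "(f, w) \<in> S" "(g, z) \<in> S" and eq: "f(u f := w) = g(u g := z)"
    have A: "f \<in> ?A" "g \<in> ?A" using S by (auto simp: S_def)
    have u: "u f = u g"
      using redirect[OF A(1) order_refl, of w] redirect[OF A(2) order_refl, of z] eq
      by (simp add: u_def)
    have "w = z" using fun_cong[OF eq, of "u f"] u by simp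
    moreover have "f x = g x" for x
      using fun_cong[OF eq, of x] close[OF A(1)] close[OF A(2)] u by (cases "x = u f") auto
    ultimately show "f = g \<and> w = z" by auto
  qed
  have sub: "(\<lambda>(f, w). f(u f := w)) ` S \<subseteq> \<F>"
    using uV by (auto simp: S_def \<F>_def PiE_def Pi_def extensional_def)
  have "d * real (card ?A) = (\<Sum>f\<in>?A. d)" by simp
  also have "\<dots> \<le> (\<Sum>f\<in>?A. real (card (N (u f))))"
    using assms(3) uV by (intro sum_mono) auto
  also have "\<dots> = real (card S)"
    unfolding S_def using assms(3) uV finF by (subst card_SigmaI) auto
  also have "\<dots> \<le> real (card \<F>)" using card_inj_on_le[OF inj sub finF] by simp
  finally show ?thesis .
qed

text \<open>A pair \<open>(v, l)\<close> occurs in at most \<open>card \<F> / d\<close> functions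
  and has weight \<open>1 / l\<close>. Summing over \<open>l\<close> gives the harmonic number,
  summing over \<open>v\<close> the factor \<open>card V\<close>.\<close>

lemma sum_card_cycles_le:
  fixes d :: real
  assumes "finite V" "d > 0"
    "\<And>u. u \<in> V \<Longrightarrow> finite (N u) \<and> N u \<subseteq> V \<and> d \<le> real (card (N u))"
  defines "\<F> \<equiv> Pi\<^sub>E V N"
  shows "(\<Sum>f\<in>\<F>. real (card (cycles V f))) \<le> harm (card V) * real (card V) / d * real (card \<F>)"
proof -
  have FV: "f \<in> V \<rightarrow> V" if "f \<in> \<F>" for f using that assms(3) by (auto simp: \<F>_def PiE_def Pi_def)
  have finF: "finite \<F>" unfolding \<F>_def using assms(1,3) by (intro finite_PiE) auto
  let ?c = "\<lambda>f v l. if v \<in> orbit f v \<and> card (orbit f v) = l then 1 / real l else 0"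
  have "(\<Sum>f\<in>\<F>. real (card (cycles V f))) = (\<Sum>f\<in>\<F>. \<Sum>v\<in>V. \<Sum>l=1..card V. ?c f v l)"
    using card_cycles_eq[OF assms(1) FV] by (intro sum.cong) auto
  also have "\<dots> = (\<Sum>v\<in>V. \<Sum>l=1..card V. \<Sum>f\<in>\<F>. ?c f v l)"
    by (subst sum.swap, intro sum.cong refl, rule sum.swap)
  also have "\<dots> \<le> (\<Sum>v\<in>V. \<Sum>l=1..card V. inverse (real l) * (real (card \<F>) / d))"
  proof (intro sum_mono)
    fix v l assume v: "v \<in> V" and l: "l \<in> {1..card V}"
    then obtain m where m: "l = Suc m" by (cases l) auto
    have "(\<Sum>f\<in>\<F>. ?c f v l) = real (card {f \<in> \<F>. v \<in> orbit f v \<and> card (orbit f v) = l}) / real l"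
      by (subst sum.inter_filter[symmetric, OF finF]) simp
    also have "\<dots> \<le> real (card \<F>) / d / real l"
      using card_period_le[where N = N and d = d and m = m, OF assms(1) v assms(3)] assms(2) m unfolding \<F>_def
      by (intro divide_right_mono) (auto simp: field_simps)
    finally show "(\<Sum>f\<in>\<F>. ?c f v l) \<le> inverse (real l) * (real (card \<F>) / d)"
      by (simp add: field_simps)
  qed
  also have "\<dots> = harm (card V) * real (card V) / d * real (card \<F>)"
    unfolding sum_distrib_right[symmetric] harm_def by simp
  finally show ?thesis .
qed

text \<open>Markov's inequality: \<open>k + 1\<close> is at least twice the bound on the mean number
  of cycles, so at most half of the functions have more than \<open>k\<close>.\<close>

lemma card_few_cycles_ge:
  fixes d :: real
  assumes "finite V" "d > 0"
    "\<And>u. u \<in> V \<Longrightarrow> finite (N u) \<and> N u \<subseteq> V \<and> d \<le> real (card (N u))"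
    and k: "2 * (harm (card V) * real (card V) / d) \<le> real k + 1"
  defines "\<F> \<equiv> Pi\<^sub>E V N"
  shows "card \<F> \<le> 2 * card {f \<in> \<F>. card (cycles V f) \<le> k}"
proof -
  have finF: "finite \<F>" unfolding \<F>_def using assms(1,3) by (intro finite_PiE) auto
  let ?B = "{f \<in> \<F>. \<not> card (cycles V f) \<le> k}"
  have "2 * (real k + 1) * real (card ?B) = 2 * (\<Sum>f\<in>?B. real k + 1)" by simp
  also have "\<dots> \<le> 2 * (\<Sum>f\<in>?B. real (card (cycles V f)))"
    by (intro mult_left_mono sum_mono) auto
  also have "\<dots> \<le> 2 * (\<Sum>f\<in>\<F>. real (card (cycles V f)))"
    using finF by (intro mult_left_mono sum_mono2) auto
  also have "\<dots> \<le> 2 * (harm (card V) * real (card V) / d) * real (card \<F>)"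
    using sum_card_cycles_le[where N = N, OF assms(1,2,3)] unfolding \<F>_def by simp
  also have "\<dots> \<le> (real k + 1) * real (card \<F>)" using k by (intro mult_right_mono) auto
  finally have "(real k + 1) * (2 * real (card ?B)) \<le> (real k + 1) * real (card \<F>)"
    by (simp only: mult_ac)
  hence "2 * real (card ?B) \<le> real (card \<F>)" by (rule mult_left_le_imp_le) simp
  moreover have "card \<F> = card {f \<in> \<F>. card (cycles V f) \<le> k} + card ?B"
    using finF by (subst card_Un_disjoint[symmetric]) (auto intro: arg_cong[of _ _ card])
  ultimately show ?thesis by linarith
qed

section \<open>Encoding choice functions by spanning trees\<close>

lemma card_bounded_subsets_le:
  assumes "finite A"
  shows "card {B. B \<subseteq> A \<and> card B \<le> k} \<le> (card A + 1) ^ k"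
proof -
  have "{B. B \<subseteq> A \<and> card B \<le> k} = (\<Union>i\<in>{..k}. {B. B \<subseteq> A \<and> card B = i})" by auto
  also have "card \<dots> \<le> (\<Sum>i\<le>k. card {B. B \<subseteq> A \<and> card B = i})" by (rule card_UN_le) simp
  \<comment> \<open>The inserted factor \<open>k choose i\<close> is positive for
    \<open>i \<le> k\<close> and turns the sum into a binomial expansion.\<close>
  also have "\<dots> \<le> (\<Sum>i\<le>k. (k choose i) * card A ^ i)"
  proof (rule sum_mono)
    fix i assume i: "i \<in> {..k}"
    have "card {B. B \<subseteq> A \<and> card B = i} = card A choose i" using n_subsets[OF assms] .
    also have "\<dots> \<le> card A ^ i"
      by (cases "i \<le> card A") (auto intro: binomial_le_pow simp: binomial_eq_0)
    also have "1 * card A ^ i \<le> (k choose i) * card A ^ i"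
      using i by (intro mult_right_mono) (auto simp: Suc_le_eq)
    finally show "card {B. B \<subseteq> A \<and> card B = i} \<le> (k choose i) * card A ^ i" by simp
  qed
  also have "\<dots> = (card A + 1) ^ k" using binomial_ring[of "card A" 1 k] by simp
  finally show ?thesis .
qed

text \<open>
  The function is determined by \<open>T\<close>, \<open>D\<close>, \<open>R\<close> and its values on \<open>R\<close>: the height \<open>h\<close> certifies that
  the edges \<open>T - D\<close> are oriented towards \<open>R\<close>, and such an orientation is unique.
\<close>

lemma few_cycles_spanning_tree:
  assumes "simple_graph V E" "connected_graph V E"
    "f \<in> Pi\<^sub>E V (neighbours E)" "card (cycles V f) \<le> k"
  shows "\<exists>T D R. spanning_tree V E T \<and> D \<subseteq> E \<and> card D \<le> k \<and> R \<subseteq> V \<and> card R \<le> k \<and>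
    (\<exists>h :: 'a \<Rightarrow> nat. \<forall>v\<in>V - R. h (f v) < h v) \<and> (\<lambda>v. {v, f v}) ` (V - R) = T - D"
proof -
  have fin: "finite V" using assms(1) by (simp add: simple_graph_def)
  have fV: "f \<in> V \<rightarrow> V" using assms(3) neighbours_subset[OF assms(1)] by (auto simp: PiE_def Pi_def)
  obtain R where R: "R \<subseteq> V" "card R \<le> card (cycles V f)"
    and hit: "\<forall>v\<in>V. \<exists>k. (f ^^ k) v \<in> R"
    using cycle_representatives[OF fin fV] by (elim exE conjE) (rule that)
  have Rk: "card R \<le> k" using R(2) assms(4) by simp
  \<comment> \<open>Number of steps until the trajectory of \<open>v\<close> meets
    \<open>R\<close>.\<close>
  define h where "h v = (LEAST k. (f ^^ k) v \<in> R)" for v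
  have desc: "h (f v) < h v" if v: "v \<in> V - R" for v
  proof -
    have "\<exists>k. (f ^^ k) v \<in> R" using hit v by simp
    hence hv: "(f ^^ h v) v \<in> R" unfolding h_def by (rule LeastI_ex)
    hence "h v \<noteq> 0" using v by (intro notI) simp
    then obtain m where m: "h v = Suc m" using not0_implies_Suc by blast
    have "(f ^^ m) (f v) \<in> R" using hv unfolding m funpow_Suc_right by simp
    hence "h (f v) \<le> m" unfolding h_def by (rule Least_le)
    thus ?thesis using m by simp
  qed
  define F where "F = (\<lambda>v. {v, f v}) ` (V - R)"
  have "F \<subseteq> E" using assms(3) by (auto simp: F_def neighbours_def)
  moreover have "\<nexists>c. graph_cycle F c" unfolding F_def using descending_map_acyclic[where h = h and f = f and A = "V - R", OF desc] by blast
  ultimately obtain T where T: "spanning_tree V E T" "F \<subseteq> T"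
    using acyclic_extends_to_spanning_tree[OF assms(1,2)] by blast
  \<comment> \<open>\<open>F\<close> has one edge for each vertex outside \<open>R\<close>, and
    \<open>T\<close> has at most \<open>card V - 1\<close> edges, so \<open>T - F\<close> has at
    most \<open>card R\<close> edges.\<close>
  have "card F = card V - card R"
    unfolding F_def using descending_map_edge_inj_on[where h = h and f = f and A = "V - R", OF desc] R(1) fin
    by (simp add: card_image card_Diff_subset finite_subset)
  moreover have "card (T - F) = card T - card F"
    using T fin by (intro card_Diff_subset) (auto simp: F_def)
  ultimately have D: "card (T - F) \<le> k"
    using card_spanning_tree_le[OF assms(1) T(1)] Rk by linarith
  have DE: "T - F \<subseteq> E" using T(1) by (auto simp: spanning_tree_def)
  have TF: "(\<lambda>v. {v, f v}) ` (V - R) = T - (T - F)" using T(2) unfolding F_def by blast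
  have "\<exists>h :: 'a \<Rightarrow> nat. \<forall>v\<in>V - R. h (f v) < h v" by (intro exI[of _ h] ballI desc)
  with D DE TF show ?thesis
    by (intro exI[of _ T] exI[of _ "T - F"] exI[of _ R] conjI T(1) R(1) Rk)
qed

text \<open>The code of \<open>f\<close> consists of \<open>T\<close>, \<open>D\<close> and the
  pairs \<open>(v, f v)\<close> with \<open>v\<close> in \<open>R\<close>; the set \<open>R\<close>
  is read off from the first components. The last two items are sets of at most \<open>k\<close>
  elements, drawn from sets of size at most \<open>(card V)\<^sup>2\<close>.\<close>

lemma card_few_cycles_le:
  assumes "simple_graph V E" "connected_graph V E"
  shows "card {f \<in> Pi\<^sub>E V (neighbours E). card (cycles V f) \<le> k} \<le>
    num_spanning_trees V E * ((card V)\<^sup>2 + 1) ^ (2 * k)"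
proof -
  have fin: "finite V" and finE: "finite E"
    using assms(1) finite_edges by (auto simp: simple_graph_def)
  let ?G = "{f \<in> Pi\<^sub>E V (neighbours E). card (cycles V f) \<le> k}"
  let ?ST = "{T. spanning_tree V E T}" and ?DS = "{D. D \<subseteq> E \<and> card D \<le> k}"
  let ?RS = "{P. P \<subseteq> V \<times> V \<and> card P \<le> k}"
  define enc where "enc f T D R \<longleftrightarrow>
    spanning_tree V E T \<and> D \<subseteq> E \<and> card D \<le> k \<and> R \<subseteq> V \<and> card R \<le> k \<and>
    (\<exists>h :: 'a \<Rightarrow> nat. \<forall>v\<in>V - R. h (f v) < h v) \<and> (\<lambda>v. {v, f v}) ` (V - R) = T - D"
    for f T D R
  have "\<exists>T D R. enc f T D R" if "f \<in> ?G" for f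
    using few_cycles_spanning_tree[OF assms, of f k] that unfolding enc_def by blast
  then obtain T D R where enc: "\<And>f. f \<in> ?G \<Longrightarrow> enc f (T f) (D f) (R f)" by metis
  note enc = enc[unfolded enc_def]
  define code where "code f = (T f, D f, (\<lambda>v. (v, f v)) ` R f)" for f
  have "inj_on code ?G"
  proof (rule inj_onI)
    fix f g assume f: "f \<in> ?G" and g: "g \<in> ?G" and eq: "code f = code g"
    have TD: "T f = T g" "D f = D g" and im: "(\<lambda>v. (v, f v)) ` R f = (\<lambda>v. (v, g v)) ` R g"
      using eq by (auto simp: code_def)
    have RR: "R f = R g" using arg_cong[OF im, of "image fst"] by (simp add: image_image)
    have on_R: "f v = g v" if "v \<in> R f" for v using im that by auto
    have edges: "(\<lambda>v. {v, f v}) ` (V - R f) = (\<lambda>v. {v, g v}) ` (V - R f)"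
      using enc[OF f] enc[OF g] TD RR by simp
    have off_R: "f v = g v" if "v \<in> V - R f" for v
    proof -
      obtain h :: "'a \<Rightarrow> nat" where "\<And>v. v \<in> V - R f \<Longrightarrow> h (f v) < h v" using enc[OF f] by blast
      thus ?thesis using edges that by (rule descending_map_edges_inj)
    qed
    show "f = g"
    proof
      \<comment> \<open>Outside \<open>V\<close> both functions take the default value of
        extensional functions.\<close>
      fix v show "f v = g v"
        using on_R off_R f g by (cases "v \<in> V") (auto simp: PiE_def extensional_def)
    qed
  qed
  moreover have "code ` ?G \<subseteq> ?ST \<times> ?DS \<times> ?RS"
  proof (rule image_subsetI)
    fix f assume f: "f \<in> ?G"
    have RV: "R f \<subseteq> V" "card (R f) \<le> k" using enc[OF f] by auto
    have "card ((\<lambda>v. (v, f v)) ` R f) \<le> k"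
      using RV fin by (meson card_image_le finite_subset le_trans)
    moreover have "(\<lambda>v. (v, f v)) ` R f \<subseteq> V \<times> V"
      using f RV(1) neighbours_subset[OF assms(1)] by (fastforce simp: PiE_def Pi_def)
    ultimately show "code f \<in> ?ST \<times> ?DS \<times> ?RS" using enc[OF f] by (simp add: code_def)
  qed
  moreover have "finite (?ST \<times> ?DS \<times> ?RS)"
    using finite_spanning_trees[OF assms(1)] fin finE by simp
  ultimately have "card ?G \<le> card (?ST \<times> ?DS \<times> ?RS)" by (rule card_inj_on_le)
  also have "\<dots> = num_spanning_trees V E * (card ?DS * card ?RS)"
    by (simp add: card_cartesian_product num_spanning_trees_def)
  also have "\<dots> \<le> num_spanning_trees V E * (((card V)\<^sup>2 + 1) ^ k * ((card V)\<^sup>2 + 1) ^ k)"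
  proof (intro mult_le_mono order_refl)
    have "card ?DS \<le> (card E + 1) ^ k" using card_bounded_subsets_le[OF finE] .
    also have "\<dots> \<le> ((card V)\<^sup>2 + 1) ^ k" using card_edges_le[OF assms(1)] by (intro power_mono) auto
    finally show "card ?DS \<le> ((card V)\<^sup>2 + 1) ^ k" .
    show "card ?RS \<le> ((card V)\<^sup>2 + 1) ^ k"
      using card_bounded_subsets_le[of "V \<times> V" k] fin by (simp add: card_cartesian_product power2_eq_square)
  qed
  finally show ?thesis by (simp add: mult_2 power_add)
qed

text \<open>The product of the degrees counts the choice functions, of which at least half have few
  cycles.\<close>

lemma prod_degree_le:
  assumes "simple_graph V E" "connected_graph V E" "\<delta> > 0"
    "\<And>v. v \<in> V \<Longrightarrow> \<delta> * real (card V) \<le> real (vertex_degree E v)"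
  shows "(\<Prod>v\<in>V. vertex_degree E v) \<le>
    2 * (num_spanning_trees V E * ((card V)\<^sup>2 + 1) ^ (2 * nat \<lfloor>2 * harm (card V) / \<delta>\<rfloor>))"
proof -
  have fin: "finite V" using assms(1) by (simp add: simple_graph_def)
  have "V \<noteq> {}" using assms(2) by (simp add: connected_graph_def)
  hence n: "card V > 0" using fin by (simp add: card_gt_0_iff)
  \<comment> \<open>With \<open>d = \<delta> * card V\<close> the mean number of cycles is at most
    \<open>harm (card V) / \<delta>\<close>; \<open>?k\<close> is the integer part of twice this
    bound.\<close>
  let ?k = "nat \<lfloor>2 * harm (card V) / \<delta>\<rfloor>"
  have "(\<Prod>v\<in>V. vertex_degree E v) = card (Pi\<^sub>E V (neighbours E))"
    using fin by (simp add: card_PiE card_neighbours[OF assms(1)])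
  also have "\<dots> \<le> 2 * card {f \<in> Pi\<^sub>E V (neighbours E). card (cycles V f) \<le> ?k}"
  proof (rule card_few_cycles_ge[OF fin, of "\<delta> * real (card V)"])
    show "finite (neighbours E u) \<and> neighbours E u \<subseteq> V \<and>
        \<delta> * real (card V) \<le> real (card (neighbours E u))" if "u \<in> V" for u
      using assms(4)[OF that] neighbours_subset[OF assms(1), of u] fin
      by (simp add: card_neighbours[OF assms(1)] finite_subset)
    have "2 * harm (card V) / \<delta> \<le> real ?k + 1" by linarith
    thus "2 * (harm (card V) * real (card V) / (\<delta> * real (card V))) \<le> real ?k + 1"
      using n by simp
  qed (use n assms(3) in simp)
  also have "\<dots> \<le> 2 * (num_spanning_trees V E * ((card V)\<^sup>2 + 1) ^ (2 * ?k))"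
    using card_few_cycles_le[OF assms(1,2)] by simp
  finally show ?thesis .
qed

section \<open>Degrees of graphons and the cut norm\<close>

lemma unit_space_simps [simp]:
  "space unit_space = {0..1}" "measure unit_space {0..1} = 1" "{0..1::real} \<in> sets unit_space"
  by (simp_all add: measure_restrict_space)

lemma finite_measure_unit: "finite_measure unit_space"
  by (rule finite_measure_lebesgue_on) auto

lemma unit_integrable_bounded:
  fixes f :: "real \<Rightarrow> real"
  assumes "f \<in> borel_measurable unit_space" "\<And>x. x \<in> {0..1} \<Longrightarrow> \<bar>f x\<bar> \<le> B"
  shows "integrable unit_space f"
  using assms by (intro finite_measure.integrable_const_bound[OF finite_measure_unit, of _ B]) auto

text \<open>A non-integrable function has integral \<open>0\<close> by convention, so the bound also
  covers the exceptional sections of a graphon.\<close>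

lemma unit_integral_abs_le:
  fixes f :: "real \<Rightarrow> real"
  assumes "\<And>x. x \<in> {0..1} \<Longrightarrow> \<bar>f x\<bar> \<le> B" "0 \<le> B"
  shows "\<bar>LINT x|unit_space. f x\<bar> \<le> B"
proof (cases "integrable unit_space f")
  case True
  have "\<bar>LINT x|unit_space. f x\<bar> \<le> (LINT x|unit_space. \<bar>f x\<bar>)" by (rule integral_abs_bound)
  also have "\<dots> \<le> (LINT x|unit_space. B)"
    using True assms(1) by (intro integral_mono integrable_abs) auto
  finally show ?thesis by simp
qed (use assms(2) in \<open>simp add: not_integrable_integral_eq\<close>)

lemma unit_measurable_iff:
  fixes f :: "real \<Rightarrow> real"
  shows "f \<in> borel_measurable unit_space \<longleftrightarrow> (\<lambda>x. indicator {0..1} x * f x) \<in> borel_measurable lebesgue"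
  using borel_measurable_restrict_space_iff[of "{0..1::real}" lebesgue f] by simp

lemma AE_unit_iff: "(AE x in unit_space. Q x) \<longleftrightarrow> (AE x in lebesgue. x \<in> {0..1::real} \<longrightarrow> Q x)"
  by (rule AE_restrict_space_iff) simp

text \<open>Completeness of the Lebesgue measure permits changes on null sets.\<close>

lemma unit_measurable_AE:
  fixes f g :: "real \<Rightarrow> real"
  assumes "f \<in> borel_measurable unit_space" "AE x in unit_space. f x = g x"
  shows "g \<in> borel_measurable unit_space"
proof -
  have "AE x in lebesgue. indicator {0..1} x * f x = indicator {0..1} x * g x"
    using assms(2) unfolding AE_unit_iff by eventually_elim (auto simp: indicator_def)
  from borel_measurable_AE[OF assms(1)[unfolded unit_measurable_iff] this]
  show ?thesis unfolding unit_measurable_iff .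
qed

text \<open>A graphon is Lebesgue measurable on the square, so it is first replaced by a Borel
  function \<open>g'\<close> that agrees with it almost everywhere. Sections of \<open>g'\<close>
  and their integrals are measurable, and this carries over to \<open>W\<close> outside a null set
  of points \<open>x\<close>.\<close>

lemma graphon_sections:
  assumes "graphon W"
  shows "AE x in unit_space. W x \<in> borel_measurable unit_space"
    and "graphon_degree W \<in> borel_measurable unit_space"
proof -
  let ?g = "\<lambda>x y. indicator {0..1} x * (indicator {0..1} y * W x y)"
  have "{0..1} \<times> {0..1} = cbox (0, 0) (1 :: real, 1 :: real)"
    by (subst cbox_Pair_eq) (simp only: cbox_interval)
  hence "{0..1 :: real} \<times> {0..1 :: real} \<in> sets lebesgue"
    using fmeasurableD[OF lmeasurable_cbox[of "(0, 0)" "(1 :: real, 1 :: real)"]] by (simp only:)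
  hence "{0..1 :: real} \<times> {0..1 :: real} \<inter> space lebesgue \<in> sets lebesgue" by simp
  hence "(\<lambda>p. indicator ({0..1} \<times> {0..1}) p *\<^sub>R (case p of (x, y) \<Rightarrow> W x y)) \<in> borel_measurable lebesgue"
    using conjunct1[OF assms[unfolded graphon_def]] by (subst borel_measurable_restrict_space_iff[symmetric])
  also have "(\<lambda>p. indicator ({0..1} \<times> {0..1}) p *\<^sub>R (case p of (x, y) \<Rightarrow> W x y)) = (\<lambda>(x, y). ?g x y)"
    by (simp add: fun_eq_iff indicator_times)
  finally have "(\<lambda>(x, y). ?g x y) \<in> borel_measurable (completion lborel)" .
  from completion_ex_borel_measurable_real[OF this]
  obtain g' where g'0: "g' \<in> borel_measurable lborel"
    and ae0: "AE p in lborel. (case p of (x, y) \<Rightarrow> ?g x y) = g' p"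
    by (elim bexE) (rule that)
  have g'[measurable]: "g' \<in> borel_measurable (lborel \<Otimes>\<^sub>M lborel)"
    using g'0 by (simp add: lborel_prod)
  \<comment> \<open>Almost every section of a null set of the plane is null.\<close>
  have "AE x in lborel. AE y in lborel. ?g x y = g' (x, y)"
    using lborel_pair.AE_pair[OF ae0[folded lborel_prod]] by simp
  hence ae: "AE x in unit_space. AE y in lebesgue. ?g x y = g' (x, y)"
    unfolding AE_unit_iff AE_completion_iff by eventually_elim blast
  have sec: "W x \<in> borel_measurable unit_space" "(LINT y|lborel. g' (x, y)) = graphon_degree W x"
    if x: "x \<in> {0..1}" and ae: "AE y in lebesgue. ?g x y = g' (x, y)" for x
  proof -
    have sm: "(\<lambda>y. g' (x, y)) \<in> borel_measurable lborel" by measurable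
    hence sm': "(\<lambda>y. g' (x, y)) \<in> borel_measurable lebesgue" by (rule measurable_completion)
    have ae': "AE y in lebesgue. g' (x, y) = indicator {0..1} y * W x y"
      using ae by eventually_elim (use x in simp)
    have m: "(\<lambda>y. indicator {0..1} y * W x y) \<in> borel_measurable lebesgue"
      using borel_measurable_AE[OF sm' ae'] .
    thus "W x \<in> borel_measurable unit_space" unfolding unit_measurable_iff .
    have "(LINT y|lborel. g' (x, y)) = (LINT y|lebesgue. g' (x, y))"
      using sm by (simp add: integral_completion)
    also have "\<dots> = (LINT y|lebesgue. indicator {0..1} y * W x y)"
      using sm' m ae' by (rule integral_cong_AE)
    also have "\<dots> = graphon_degree W x"
      unfolding graphon_degree_def by (subst integral_restrict_space) simp_all
    finally show "(LINT y|lborel. g' (x, y)) = graphon_degree W x" .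
  qed
  show "AE x in unit_space. W x \<in> borel_measurable unit_space"
    using ae AE_space by eventually_elim (rule sec(1); simp only: unit_space_simps)
  have "(\<lambda>x. LINT y|lborel. g' (x, y)) \<in> borel_measurable lborel" by measurable
  hence "(\<lambda>x. LINT y|lborel. g' (x, y)) \<in> borel_measurable unit_space"
    by (intro measurable_restrict_space1 measurable_completion)
  moreover have "AE x in unit_space. (LINT y|lborel. g' (x, y)) = graphon_degree W x"
    using ae AE_space by eventually_elim (rule sec(2); simp only: unit_space_simps)
  ultimately show "graphon_degree W \<in> borel_measurable unit_space" by (rule unit_measurable_AE)
qed

lemma graphon_degree_le_one:
  assumes "graphon W" "x \<in> {0..1}"
  shows "\<bar>graphon_degree W x\<bar> \<le> 1"
  unfolding graphon_degree_def
proof (rule unit_integral_abs_le)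
  show "\<bar>W x y\<bar> \<le> 1" if "y \<in> {0..1}" for y
    using assms that by (simp add: graphon_def)
qed simp

section \<open>The cut norm controls the distance of degree functions\<close>

text \<open>The supremum of a set of reals is an upper bound only if the set is bounded above; the
  uniform bound on \<open>U\<close> provides this.\<close>

lemma cut_norm_upper:
  assumes "\<And>x y. x \<in> {0..1} \<Longrightarrow> y \<in> {0..1} \<Longrightarrow> \<bar>U x y\<bar> \<le> B" "0 \<le> B"
    and "S \<in> sets unit_space" "S' \<in> sets unit_space"
  shows "\<bar>LINT x:S|unit_space. (LINT y:S'|unit_space. U x y)\<bar> \<le> cut_norm U"
proof -
  have "\<bar>LINT x:S|unit_space. (LINT y:S'|unit_space. U x y)\<bar> \<le> B" for S S'
    unfolding set_lebesgue_integral_def using assms(1,2)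
    by (intro unit_integral_abs_le) (auto simp: indicator_def intro!: unit_integral_abs_le)
  hence "bdd_above ((\<lambda>(S, S'). \<bar>LINT x:S|unit_space. (LINT y:S'|unit_space. U x y)\<bar>) `
      (sets unit_space \<times> sets unit_space))"
    by (intro bdd_aboveI2[of _ _ B]) auto
  from cSUP_upper[OF _ this, of "(S, S')"] show ?thesis
    unfolding cut_norm_def using assms(3,4) by simp
qed

text \<open>Makes the infimum in \<open>cut_distance\<close> range over a nonempty set.\<close>

lemma mp_automorphism_id: "mp_automorphism (\<lambda>x. x)"
proof -
  have "the_inv_into {0..1::real} (\<lambda>x. x) \<in> measurable unit_space unit_space \<longleftrightarrow>
      (\<lambda>x. x) \<in> measurable unit_space unit_space"
    by (intro measurable_cong) (auto intro!: the_inv_into_f_eq)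
  moreover have "distr unit_space unit_space (\<lambda>x. x) = unit_space"
    using distr_id[of unit_space] by (simp add: id_def)
  ultimately show ?thesis by (simp add: mp_automorphism_def bij_betw_def)
qed

lemma mp_automorphism_carrier: "mp_automorphism \<phi> \<Longrightarrow> x \<in> {0..1} \<Longrightarrow> \<phi> x \<in> {0..1}"
  unfolding mp_automorphism_def by (metis bij_betwE)

lemma mp_automorphism_integral:
  fixes f :: "real \<Rightarrow> real"
  assumes "mp_automorphism \<phi>" "f \<in> borel_measurable unit_space"
  shows "(LINT x|unit_space. f (\<phi> x)) = (LINT x|unit_space. f x)"
proof -
  have "distr unit_space unit_space \<phi> = unit_space" "\<phi> \<in> measurable unit_space unit_space"
    using assms(1) by (auto simp: mp_automorphism_def)
  thus ?thesis using integral_distr[of \<phi> unit_space unit_space f] assms(2) by metis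
qed

text \<open>On \<open>S \<times> {0..1}\<close> the double integral is the integral over
  \<open>S\<close> of the degree difference \<open>h\<close>. The sets where
  \<open>0 \<le> h\<close> and \<open>h < 0\<close> give its positive and negative parts, hence the
  factor \<open>2\<close>.\<close>

lemma degree_L1_le_cut_norm:
  assumes W: "graphon W" and \<phi>: "mp_automorphism \<phi>"
    and U: "\<And>x. x \<in> {0..1} \<Longrightarrow> U x \<in> borel_measurable unit_space"
      "\<And>x y. x \<in> {0..1} \<Longrightarrow> y \<in> {0..1} \<Longrightarrow> \<bar>U x y\<bar> \<le> 1"
    and dU: "graphon_degree U \<in> borel_measurable unit_space"
  shows "(LINT x|unit_space. \<bar>graphon_degree W (\<phi> x) - graphon_degree U x\<bar>) \<le>
    2 * cut_norm (\<lambda>x y. W (\<phi> x) (\<phi> y) - U x y)"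
proof -
  let ?D = "\<lambda>x y. W (\<phi> x) (\<phi> y) - U x y"
  define h where "h x = graphon_degree W (\<phi> x) - graphon_degree U x" for x
  have \<phi>m[measurable]: "\<phi> \<in> measurable unit_space unit_space"
    and distr: "distr unit_space unit_space \<phi> = unit_space"
    using \<phi> by (auto simp: mp_automorphism_def)
  note [measurable] = graphon_sections(2)[OF W] dU
  have hm[measurable]: "h \<in> borel_measurable unit_space" unfolding h_def by measurable
  have dU1: "\<bar>graphon_degree U x\<bar> \<le> 1" if "x \<in> {0..1}" for x
    unfolding graphon_degree_def using U(2) that by (intro unit_integral_abs_le) auto
  have h2: "\<bar>h x\<bar> \<le> 2" if "x \<in> {0..1}" for x
    using graphon_degree_le_one[OF W mp_automorphism_carrier[OF \<phi> that]] dU1[OF that]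
    unfolding h_def by linarith
  have Dle: "\<bar>?D x y\<bar> \<le> 2" if "x \<in> {0..1}" "y \<in> {0..1}" for x y
  proof -
    have "0 \<le> W (\<phi> x) (\<phi> y)" "W (\<phi> x) (\<phi> y) \<le> 1"
      using W mp_automorphism_carrier[OF \<phi> that(1)] mp_automorphism_carrier[OF \<phi> that(2)]
      by (auto simp: graphon_def)
    thus ?thesis using U(2)[OF that] by linarith
  qed
  \<comment> \<open>Integration over all \<open>y\<close> removes \<open>\<phi>\<close> from the
    second argument of \<open>W\<close>, because \<open>\<phi>\<close> preserves measure.\<close>
  have inner: "(LINT y:{0..1}|unit_space. ?D x y) = h x"
    if x: "x \<in> {0..1}" and Wm: "W (\<phi> x) \<in> borel_measurable unit_space" for x
  proof -
    have "\<bar>W (\<phi> x) (\<phi> y)\<bar> \<le> 1" if "y \<in> {0..1}" for y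
      using W mp_automorphism_carrier[OF \<phi> x] mp_automorphism_carrier[OF \<phi> that]
      by (simp add: graphon_def)
    hence "integrable unit_space (\<lambda>y. W (\<phi> x) (\<phi> y))"
      by (rule unit_integrable_bounded[OF measurable_compose[OF \<phi>m Wm]])
    moreover have "integrable unit_space (U x)"
      by (rule unit_integrable_bounded[OF U(1)[OF x] U(2)[OF x]])
    moreover have "(LINT y:{0..1}|unit_space. ?D x y) = (LINT y|unit_space. ?D x y)"
      unfolding set_lebesgue_integral_def by (intro Bochner_Integration.integral_cong) auto
    ultimately show ?thesis
      unfolding h_def graphon_degree_def using mp_automorphism_integral[OF \<phi> Wm] by simp
  qed
  \<comment> \<open>The points \<open>x\<close> whose image \<open>\<phi> x\<close> has a
    non-measurable section form a null set, again by measure preservation.\<close>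
  have "AE x in distr unit_space unit_space \<phi>. W x \<in> borel_measurable unit_space"
    using graphon_sections(1)[OF W] unfolding distr .
  hence "AE x in unit_space. W (\<phi> x) \<in> borel_measurable unit_space"
    by (rule AE_distrD[OF \<phi>m])
  hence ae: "AE x in unit_space. h x = (LINT y:{0..1}|unit_space. ?D x y)"
    using AE_space by eventually_elim (use inner in simp)
  have iae: "AE x in unit_space. indicator S x *\<^sub>R h x = indicator S x *\<^sub>R (LINT y:{0..1}|unit_space. ?D x y)" for S
    using ae by eventually_elim simp
  have S: "\<bar>LINT x:S|unit_space. h x\<bar> \<le> cut_norm ?D" if [measurable]: "S \<in> sets unit_space" for S
  proof -
    have "(\<lambda>x. indicator S x *\<^sub>R h x) \<in> borel_measurable unit_space" by measurable
    hence "(LINT x:S|unit_space. h x) = (LINT x:S|unit_space. LINT y:{0..1}|unit_space. ?D x y)"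
      unfolding set_lebesgue_integral_def[of _ S]
      using unit_measurable_AE[OF _ iae[of S, unfolded real_scaleR_def]] iae[of S]
      by (intro integral_cong_AE) auto
    thus ?thesis using cut_norm_upper[of ?D 2 S "{0..1}"] Dle that by simp
  qed
  define A where "A = {x \<in> space unit_space. 0 \<le> h x}"
  define B where "B = {x \<in> space unit_space. h x < 0}"
  have A[measurable]: "A \<in> sets unit_space" and B[measurable]: "B \<in> sets unit_space"
    unfolding A_def B_def by measurable
  have int: "integrable unit_space (\<lambda>x. indicator S x *\<^sub>R h x)" if [measurable]: "S \<in> sets unit_space" for S
  proof (rule unit_integrable_bounded[of _ 2])
    show "\<bar>indicator S x *\<^sub>R h x\<bar> \<le> 2" if "x \<in> {0..1}" for x
      using h2[OF that] by (simp add: indicator_def)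
  qed measurable
  have "(LINT x|unit_space. \<bar>h x\<bar>) = (LINT x|unit_space. indicator A x *\<^sub>R h x - indicator B x *\<^sub>R h x)"
    by (intro Bochner_Integration.integral_cong) (auto simp: A_def B_def indicator_def)
  also have "\<dots> = (LINT x:A|unit_space. h x) - (LINT x:B|unit_space. h x)"
    unfolding set_lebesgue_integral_def using int A B by simp
  also have "\<dots> \<le> 2 * cut_norm ?D" using S[OF A] S[OF B] by linarith
  finally show ?thesis by (simp add: h_def)
qed

section \<open>Graphons of finite graphs\<close>

lemma equipartition_nonempty:
  assumes "equipartition V P" shows "V \<noteq> {}"
  using assms by (auto simp: equipartition_def)

lemma equipartition_cover:
  assumes "equipartition V P" "x \<in> {0..1}"
  obtains v where "v \<in> V" "x \<in> P v"
proof -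
  have "x \<in> (\<Union>v\<in>V. P v)" using assms unfolding equipartition_def by (simp only:)
  thus thesis using that by blast
qed

text \<open>Serves for the degree function of a graph, which is constant on each part, and for its
  logarithm.\<close>

lemma equipartition_step_integral:
  assumes P: "equipartition V P" "finite V"
    and f: "\<And>v x. v \<in> V \<Longrightarrow> x \<in> P v \<Longrightarrow> f x = (a v :: real)"
  shows "f \<in> borel_measurable unit_space"
    and "(LINT x|unit_space. f x) = (\<Sum>v\<in>V. a v) / real (card V)"
proof -
  let ?s = "\<lambda>x. \<Sum>v\<in>V. a v * indicator (P v) x"
  have Pm: "P v \<in> sets unit_space" "measure unit_space (P v) = 1 / real (card V)" if "v \<in> V" for v
    using P(1) that by (auto simp: equipartition_def)
  have sub: "P v \<inter> {0..1} = P v" if "v \<in> V" for v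
    using P(1) that by (auto simp: equipartition_def)
  have int: "integrable unit_space (\<lambda>x. a v * indicator (P v) x)" if "v \<in> V" for v
    using Pm(1)[OF that] finite_measure.emeasure_finite[OF finite_measure_unit]
    by (intro integrable_mult_right integrable_real_indicator) (auto simp: top.not_eq_extremum)
  have eq: "f x = ?s x" if x: "x \<in> space unit_space" for x
  proof -
    obtain u where u: "u \<in> V" "x \<in> P u"
      using equipartition_cover[OF P(1) x[unfolded unit_space_simps]] .
    have "indicator (P v) x = (0 :: real)" if "v \<in> V - {u}" for v
      using P(1) u that by (auto simp: equipartition_def disjoint_family_on_def indicator_def)
    hence "?s x = a u * indicator (P u) x"
      by (simp add: sum.remove[OF P(2) u(1)])
    thus ?thesis using f u by simp
  qed
  have "?s \<in> borel_measurable unit_space" by (intro borel_measurable_sum borel_measurable_integrable int)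
  thus "f \<in> borel_measurable unit_space" using measurable_cong[of unit_space f ?s] eq by blast
  have "(LINT x|unit_space. f x) = (LINT x|unit_space. ?s x)"
    using eq by (intro Bochner_Integration.integral_cong) auto
  also have "\<dots> = (\<Sum>v\<in>V. LINT x|unit_space. a v * indicator (P v) x)"
    using int by (rule Bochner_Integration.integral_sum)
  also have "\<dots> = (\<Sum>v\<in>V. a v / real (card V))"
    using Pm(2) sub by (intro sum.cong) auto
  finally show "(LINT x|unit_space. f x) = (\<Sum>v\<in>V. a v) / real (card V)"
    by (simp add: sum_divide_distrib)
qed

text \<open>By disjointness of the parts, \<open>u\<close> is the only vertex whose part contains
  \<open>x\<close>.\<close>

lemma graph_graphon_section:
  assumes "simple_graph V E" "equipartition V P" "u \<in> V" "x \<in> P u"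
  shows "graph_graphon V E P x = indicator (\<Union>w\<in>neighbours E u. P w)"
proof
  fix y
  have "(\<exists>u'\<in>V. \<exists>v\<in>V. {u', v} \<in> E \<and> x \<in> P u' \<and> y \<in> P v) \<longleftrightarrow> y \<in> (\<Union>w\<in>neighbours E u. P w)"
  proof
    assume "\<exists>u'\<in>V. \<exists>v\<in>V. {u', v} \<in> E \<and> x \<in> P u' \<and> y \<in> P v"
    then obtain u' v where uv: "u' \<in> V" "{u', v} \<in> E" "x \<in> P u'" "y \<in> P v" by blast
    hence "u' = u" using assms(2,3,4) by (auto simp: equipartition_def disjoint_family_on_def)
    thus "y \<in> (\<Union>w\<in>neighbours E u. P w)" using uv by (auto simp: neighbours_def)
  next
    assume "y \<in> (\<Union>w\<in>neighbours E u. P w)"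
    thus "\<exists>u'\<in>V. \<exists>v\<in>V. {u', v} \<in> E \<and> x \<in> P u' \<and> y \<in> P v"
      using assms neighbours_subset[OF assms(1)] by (fastforce simp: neighbours_def)
  qed
  thus "graph_graphon V E P x y = indicator (\<Union>w\<in>neighbours E u. P w) y"
    by (simp add: graph_graphon_def indicator_def)
qed

text \<open>The section is the indicator of a disjoint union of \<open>vertex_degree E u\<close>
  parts of equal measure.\<close>

lemma graph_graphon_degree:
  assumes "simple_graph V E" "equipartition V P" "u \<in> V" "x \<in> P u"
  shows "graph_graphon V E P x \<in> borel_measurable unit_space"
    and "graphon_degree (graph_graphon V E P) x = real (vertex_degree E u) / real (card V)"
proof -
  have NV: "neighbours E u \<subseteq> V" using neighbours_subset[OF assms(1)] .
  have fin: "finite (neighbours E u)" using NV assms(1) by (auto simp: simple_graph_def finite_subset)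
  have sets: "P ` neighbours E u \<subseteq> sets unit_space"
    using assms(2) NV by (auto simp: equipartition_def)
  hence Un: "(\<Union>w\<in>neighbours E u. P w) \<in> sets unit_space"
    using fin by (intro sets.finite_UN) auto
  note sec = graph_graphon_section[OF assms]
  show "graph_graphon V E P x \<in> borel_measurable unit_space"
    unfolding sec using Un by simp
  have "(\<Union>w\<in>neighbours E u. P w) \<subseteq> space unit_space" using sets.sets_into_space[OF Un] .
  hence "graphon_degree (graph_graphon V E P) x = measure unit_space (\<Union>w\<in>neighbours E u. P w)"
    unfolding graphon_degree_def sec by (simp add: Int_absorb2)
  also have "\<dots> = (\<Sum>w\<in>neighbours E u. measure unit_space (P w))"
    using assms(2) NV
    by (intro finite_measure.finite_measure_finite_Union[OF finite_measure_unit fin sets])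
      (auto simp: equipartition_def intro: disjoint_family_on_mono)
  also have "\<dots> = (\<Sum>w\<in>neighbours E u. 1 / real (card V))"
    using assms(2) NV by (intro sum.cong) (auto simp: equipartition_def)
  finally show "graphon_degree (graph_graphon V E P) x = real (vertex_degree E u) / real (card V)"
    by (simp add: card_neighbours[OF assms(1)])
qed

text \<open>The infimum may fail to be attained; the strict inequality provides an automorphism
  whose cut norm is below \<open>e\<close>.\<close>

lemma degree_close_to_graph:
  assumes W: "graphon W" and G: "simple_graph V E" and P: "equipartition V P"
    and c: "cut_distance W (graph_graphon V E P) < e"
  defines "U \<equiv> graph_graphon V E P"
  shows "\<exists>\<phi>. mp_automorphism \<phi> \<and> graphon_degree U \<in> borel_measurable unit_space \<and>
    (LINT x|unit_space. \<bar>graphon_degree W (\<phi> x) - graphon_degree U x\<bar>) \<le> 2 * e"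
proof -
  have "Inf ((\<lambda>\<phi>. cut_norm (\<lambda>x y. W (\<phi> x) (\<phi> y) - U x y)) ` {\<phi>. mp_automorphism \<phi>}) < e"
    using c unfolding cut_distance_def U_def .
  from cInf_lessD[OF _ this] obtain \<phi> where \<phi>: "mp_automorphism \<phi>"
    and lt: "cut_norm (\<lambda>x y. W (\<phi> x) (\<phi> y) - U x y) < e"
    using mp_automorphism_id by blast
  have fin: "finite V" using G by (simp add: simple_graph_def)
  have dU: "graphon_degree U \<in> borel_measurable unit_space"
    unfolding U_def
    by (rule equipartition_step_integral(1)[OF P fin]) (rule graph_graphon_degree(2)[OF G P])
  have "U x \<in> borel_measurable unit_space" if x: "x \<in> {0..1}" for x
  proof -
    obtain u where "u \<in> V" "x \<in> P u" using equipartition_cover[OF P x] .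
    thus ?thesis using graph_graphon_degree(1)[OF G P] unfolding U_def by blast
  qed
  moreover have "\<bar>U x y\<bar> \<le> 1" for x y by (simp add: U_def graph_graphon_def)
  ultimately show ?thesis
    using degree_L1_le_cut_norm[OF W \<phi> _ _ dU] lt \<phi> dU by fastforce
qed

section \<open>Averages of logarithms of degrees\<close>

text \<open>From \<open>\<delta>\<close> upwards the slope of \<open>ln\<close> is at most
  \<open>1 / \<delta>\<close>.\<close>

lemma abs_ln_diff_le:
  fixes a b \<delta> :: real
  assumes "\<delta> > 0" "\<delta> \<le> a" "\<delta> \<le> b"
  shows "\<bar>ln a - ln b\<bar> \<le> \<bar>a - b\<bar> / \<delta>"
proof -
  have *: "ln x - ln y \<le> \<bar>x - y\<bar> / \<delta>" if "\<delta> \<le> x" "\<delta> \<le> y" for x y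
  proof -
    have "ln x - ln y \<le> (x - y) / y" using that assms(1) by (intro ln_diff_le) auto
    also have "\<dots> \<le> \<bar>x - y\<bar> / y" using that assms(1) by (intro divide_right_mono) auto
    also have "\<dots> \<le> \<bar>x - y\<bar> / \<delta>" using that assms(1) by (intro divide_left_mono) auto
    finally show ?thesis .
  qed
  show ?thesis using *[of a b] *[of b a] assms by (simp add: abs_minus_commute abs_le_iff)
qed

text \<open>The first bound controls how far the degree of \<open>W\<close> falls below
  \<open>\<delta>\<close>. Along a sequence with \<open>e\<close> tending to \<open>0\<close> it
  yields the almost everywhere lower bound that the second statement assumes.\<close>

lemma graph_degree_defect_and_log:
  fixes \<delta> e :: real
  assumes \<delta>: "\<delta> > 0" and W: "graphon W" and G: "simple_graph V E" and P: "equipartition V P"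
    and deg: "\<And>v. v \<in> V \<Longrightarrow> \<delta> * real (card V) \<le> real (vertex_degree E v)"
    and c: "cut_distance W (graph_graphon V E P) < e"
  shows "(LINT x|unit_space. max 0 (\<delta> - graphon_degree W x)) \<le> 2 * e"
    and "(AE x in unit_space. \<delta> \<le> graphon_degree W x) \<Longrightarrow>
      \<bar>(\<Sum>v\<in>V. ln (real (vertex_degree E v) / real (card V))) / real (card V) -
        (LINT x|unit_space. ln (graphon_degree W x))\<bar> \<le> 2 * e / \<delta>"
proof -
  define D where "D = graphon_degree W"
  define d where "d = graphon_degree (graph_graphon V E P)"
  obtain \<phi> where \<phi>: "mp_automorphism \<phi>" and dm[measurable]: "d \<in> borel_measurable unit_space"
    and L1: "(LINT x|unit_space. \<bar>D (\<phi> x) - d x\<bar>) \<le> 2 * e"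
    using degree_close_to_graph[OF W G P c] unfolding D_def d_def by blast
  have [measurable]: "D \<in> borel_measurable unit_space" unfolding D_def using graphon_sections(2)[OF W] .
  have [measurable]: "\<phi> \<in> measurable unit_space unit_space"
    and distr: "distr unit_space unit_space \<phi> = unit_space"
    using \<phi> by (auto simp: mp_automorphism_def)
  have fin: "finite V" using G by (simp add: simple_graph_def)
  have n: "real (card V) > 0" using fin equipartition_nonempty[OF P] by (simp add: card_gt_0_iff)
  have d: "d x = real (vertex_degree E v) / real (card V)" if "v \<in> V" "x \<in> P v" for v x
    unfolding d_def using graph_graphon_degree(2)[OF G P that] .
  have d_ge: "\<delta> \<le> d x" and d_le: "d x \<le> 1" if x: "x \<in> {0..1}" for x
  proof -
    obtain v where v: "v \<in> V" "x \<in> P v" using equipartition_cover[OF P x] .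
    show "\<delta> \<le> d x" using d[OF v] deg[OF v(1)] n by (simp add: pos_le_divide_eq)
    have "vertex_degree E v \<le> card V"
      using card_neighbours[OF G, of v] card_mono[OF fin neighbours_subset[OF G, of v]] by simp
    thus "d x \<le> 1" using d[OF v] n by simp
  qed
  have D1: "\<bar>D x\<bar> \<le> 1" if "x \<in> {0..1}" for x
    unfolding D_def using graphon_degree_le_one[OF W that] .
  have int_diff: "integrable unit_space (\<lambda>x. \<bar>D (\<phi> x) - d x\<bar>)"
  proof (rule unit_integrable_bounded[of _ 2])
    show "\<bar>\<bar>D (\<phi> x) - d x\<bar>\<bar> \<le> 2" if "x \<in> {0..1}" for x
      using D1[OF mp_automorphism_carrier[OF \<phi> that]] d_ge[OF that] d_le[OF that] \<delta> by linarith
  qed measurable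
  have "(LINT x|unit_space. max 0 (\<delta> - D x)) = (LINT x|unit_space. max 0 (\<delta> - D (\<phi> x)))"
    by (rule mp_automorphism_integral[OF \<phi>, symmetric]) measurable
  also have "\<dots> \<le> (LINT x|unit_space. \<bar>D (\<phi> x) - d x\<bar>)"
  proof (rule integral_mono)
    show "integrable unit_space (\<lambda>x. max 0 (\<delta> - D (\<phi> x)))"
    proof (rule unit_integrable_bounded[of _ "\<delta> + 1"])
      show "\<bar>max 0 (\<delta> - D (\<phi> x))\<bar> \<le> \<delta> + 1" if "x \<in> {0..1}" for x
        using D1[OF mp_automorphism_carrier[OF \<phi> that]] \<delta> by linarith
    qed measurable
    \<comment> \<open>The graph has normalised degrees at least \<open>\<delta>\<close>, so a defect
      of \<open>W\<close> is at most the difference of the degrees.\<close>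
    show "max 0 (\<delta> - D (\<phi> x)) \<le> \<bar>D (\<phi> x) - d x\<bar>" if "x \<in> space unit_space" for x
      using d_ge[of x] that by auto
  qed (rule int_diff)
  finally show "(LINT x|unit_space. max 0 (\<delta> - graphon_degree W x)) \<le> 2 * e"
    using L1 unfolding D_def by linarith

  assume ae: "AE x in unit_space. \<delta> \<le> graphon_degree W x"
  hence "AE x in distr unit_space unit_space \<phi>. \<delta> \<le> D x" unfolding distr D_def .
  hence ae\<phi>: "AE x in unit_space. \<delta> \<le> D (\<phi> x)" by (rule AE_distrD[rotated]) measurable
  \<comment> \<open>The degrees lie in \<open>[\<delta>, 1]\<close>, for \<open>W\<close> almost
    everywhere; there \<open>ln\<close> is bounded, so both logarithms are integrable.\<close>
  have ln_bound: "\<bar>ln y\<bar> \<le> \<bar>ln \<delta>\<bar>" if "\<delta> \<le> y" "y \<le> 1" for y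
  proof -
    have "ln \<delta> \<le> ln y" "ln y \<le> 0" using that \<delta> by auto
    thus ?thesis by linarith
  qed
  have int_d: "integrable unit_space (\<lambda>x. ln (d x))"
    using ln_bound[OF d_ge d_le] by (intro unit_integrable_bounded[of _ "\<bar>ln \<delta>\<bar>"]) auto
  have int_D: "integrable unit_space (\<lambda>x. ln (D (\<phi> x)))"
  proof (rule finite_measure.integrable_const_bound[OF finite_measure_unit])
    show "AE x in unit_space. norm (ln (D (\<phi> x))) \<le> \<bar>ln \<delta>\<bar>"
      using ae\<phi> AE_space
    proof eventually_elim
      case (elim x)
      hence "\<bar>D (\<phi> x)\<bar> \<le> 1" using D1 mp_automorphism_carrier[OF \<phi>] by simp
      thus ?case using ln_bound[of "D (\<phi> x)"] elim by simp
    qed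
  qed measurable
  have "(LINT x|unit_space. ln (d x)) =
      (\<Sum>v\<in>V. ln (real (vertex_degree E v) / real (card V))) / real (card V)"
    using d by (intro equipartition_step_integral(2)[OF P fin]) auto
  moreover have "(LINT x|unit_space. ln (D x)) = (LINT x|unit_space. ln (D (\<phi> x)))"
    by (rule mp_automorphism_integral[OF \<phi>, symmetric]) measurable
  ultimately have "\<bar>(\<Sum>v\<in>V. ln (real (vertex_degree E v) / real (card V))) / real (card V) -
      (LINT x|unit_space. ln (D x))\<bar> = \<bar>LINT x|unit_space. ln (d x) - ln (D (\<phi> x))\<bar>"
    using int_d int_D by simp
  also have "\<dots> \<le> (LINT x|unit_space. \<bar>ln (d x) - ln (D (\<phi> x))\<bar>)" by (rule integral_abs_bound)
  also have "\<dots> \<le> (LINT x|unit_space. \<bar>D (\<phi> x) - d x\<bar> / \<delta>)"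
  proof (rule integral_mono_AE)
    show "AE x in unit_space. \<bar>ln (d x) - ln (D (\<phi> x))\<bar> \<le> \<bar>D (\<phi> x) - d x\<bar> / \<delta>"
      using ae\<phi> AE_space
    proof eventually_elim
      case (elim x)
      thus ?case using abs_ln_diff_le[OF \<delta>, of "d x" "D (\<phi> x)"] d_ge[of x]
        by (simp add: abs_minus_commute)
    qed
  qed (use int_d int_D int_diff in auto)
  also have "\<dots> \<le> 2 * e / \<delta>" using L1 \<delta> by (simp add: divide_right_mono)
  finally show "\<bar>(\<Sum>v\<in>V. ln (real (vertex_degree E v) / real (card V))) / real (card V) -
      (LINT x|unit_space. ln (graphon_degree W x))\<bar> \<le> 2 * e / \<delta>"
    unfolding D_def .
qed

section \<open>The limit\<close>

text \<open>\<open>harm n - ln n\<close> decreases and equals \<open>1\<close> at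
  \<open>n = 1\<close>; \<open>decseq_harm_diff_ln\<close> is indexed from \<open>0\<close>, hence
  the shift \<open>n - 1\<close>.\<close>

lemma harm_le: "n > 0 \<Longrightarrow> harm n \<le> 1 + ln (real n)"
  using decseqD[OF decseq_harm_diff_ln, of 0 "n - 1"] by (simp add: harm_expand)

text \<open>Logarithmic form of \<open>t \<le> p \<le> 2 * (t * (n\<^sup>2 + 1) ^ (2 * k))\<close>
  with \<open>p\<close> the product of the degrees. After division by \<open>n\<close> the gap is of
  order \<open>(log n)\<^sup>2 / n\<close>.\<close>

lemma log_spanning_trees_close:
  fixes \<delta> :: real
  assumes G: "simple_graph V E" "connected_graph V E" and \<delta>: "\<delta> > 0"
    and deg: "\<And>v. v \<in> V \<Longrightarrow> \<delta> * real (card V) \<le> real (vertex_degree E v)"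
  defines "n \<equiv> real (card V)"
  shows "num_spanning_trees V E > 0"
    and "\<bar>ln (real (num_spanning_trees V E)) / n - ln n -
        (\<Sum>v\<in>V. ln (real (vertex_degree E v) / n)) / n\<bar> \<le>
      ln 2 / n + 4 / \<delta> * ((1 + ln n) * ln (n\<^sup>2 + 1) / n)"
proof -
  have fin: "finite V" using G(1) by (simp add: simple_graph_def)
  have "V \<noteq> {}" using G(2) by (simp add: connected_graph_def)
  hence card: "card V > 0" using fin by (simp add: card_gt_0_iff)
  hence n: "n > 0" by (simp add: n_def)
  have pos: "vertex_degree E v > 0" if "v \<in> V" for v
  proof -
    have "0 < \<delta> * real (card V)" using \<delta> card by simp
    also have "\<dots> \<le> real (vertex_degree E v)" by (rule deg[OF that])
    finally show ?thesis by simp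
  qed
  define t where "t = num_spanning_trees V E"
  define p where "p = (\<Prod>v\<in>V. vertex_degree E v)"
  define k where "k = nat \<lfloor>2 * harm (card V) / \<delta>\<rfloor>"
  have p: "p > 0" unfolding p_def using pos by (intro prod_pos) auto
  have up: "t \<le> p" unfolding t_def p_def using num_spanning_trees_le[OF G pos] .
  have lo: "p \<le> 2 * (t * ((card V)\<^sup>2 + 1) ^ (2 * k))"
    unfolding t_def p_def k_def using prod_degree_le[OF G \<delta> deg] .
  \<comment> \<open>For \<open>t = 0\<close> the right side of \<open>lo\<close> would vanish, while
    \<open>p\<close> is positive.\<close>
  show "num_spanning_trees V E > 0" using p lo unfolding t_def[symmetric] by (cases "t = 0") auto
  hence t: "t > 0" by (simp add: t_def)
  have "real p \<le> real (2 * (t * ((card V)\<^sup>2 + 1) ^ (2 * k)))" using lo by (simp only: of_nat_le_iff)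
  also have "\<dots> = 2 * (real t * (n\<^sup>2 + 1) ^ (2 * k))" by (simp add: n_def add.commute)
  finally have "ln (real p) \<le> ln (2 * (real t * (n\<^sup>2 + 1) ^ (2 * k)))"
    using p by (subst ln_le_cancel_iff) auto
  also have "\<dots> = ln 2 + (ln (real t) + real (2 * k) * ln (n\<^sup>2 + 1))"
  proof -
    have q: "0 < n\<^sup>2 + 1" using n by (simp add: add_pos_pos)
    show ?thesis using t q by (simp add: ln_mult ln_realpow)
  qed
  also have "\<dots> \<le> ln 2 + (ln (real t) + 4 / \<delta> * (1 + ln n) * ln (n\<^sup>2 + 1))"
  proof (intro add_left_mono mult_right_mono)
    \<comment> \<open>Nonnegativity ensures that \<open>nat\<close> of the floor does not exceed its
      argument.\<close>
    have "harm (card V) \<ge> (0 :: real)" by (rule harm_nonneg)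
    hence "real k \<le> 2 * harm (card V) / \<delta>" unfolding k_def using \<delta> by simp
    also have "\<dots> \<le> 2 * (1 + ln n) / \<delta>"
      unfolding n_def using harm_le[OF card] \<delta> by (intro divide_right_mono mult_left_mono) auto
    finally show "real (2 * k) \<le> 4 / \<delta> * (1 + ln n)" using \<delta> by (simp add: field_simps)
  qed simp
  finally have lo': "ln (real p) \<le> ln (real t) + (ln 2 + 4 / \<delta> * ((1 + ln n) * ln (n\<^sup>2 + 1)))"
    by (simp only: mult.assoc add.left_commute)
  have up': "ln (real t) \<le> ln (real p)" using up t by simp
  have "ln (real p) = (\<Sum>v\<in>V. ln (real (vertex_degree E v)))"
    unfolding p_def of_nat_prod using pos fin by (intro ln_prod) auto
  \<comment> \<open>Normalising the degrees costs \<open>ln n\<close> for each of the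
    \<open>n\<close> vertices.\<close>
  moreover have "(\<Sum>v\<in>V. ln (real (vertex_degree E v) / n)) =
      (\<Sum>v\<in>V. ln (real (vertex_degree E v)) - ln n)"
    using pos n by (intro sum.cong refl) (simp add: ln_div)
  ultimately have "(\<Sum>v\<in>V. ln (real (vertex_degree E v) / n)) = ln (real p) - n * ln n"
    by (simp add: sum_subtractf n_def)
  hence "ln (real t) / n - ln n - (\<Sum>v\<in>V. ln (real (vertex_degree E v) / n)) / n =
      (ln (real t) - ln (real p)) / n"
    using n by (simp add: diff_divide_distrib)
  also have "\<bar>\<dots>\<bar> = (ln (real p) - ln (real t)) / n" using up' n by (simp add: abs_if divide_simps)
  also have "\<dots> \<le> (ln 2 + 4 / \<delta> * ((1 + ln n) * ln (n\<^sup>2 + 1))) / n"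
    using lo' n by (intro divide_right_mono) auto
  finally show "\<bar>ln (real (num_spanning_trees V E)) / n - ln n -
        (\<Sum>v\<in>V. ln (real (vertex_degree E v) / n)) / n\<bar> \<le>
      ln 2 / n + 4 / \<delta> * ((1 + ln n) * ln (n\<^sup>2 + 1) / n)"
    by (simp add: t_def add_divide_distrib)
qed

theorem theorem1p8:
  fixes \<delta> :: real
    and W :: "real \<Rightarrow> real \<Rightarrow> real"
    and n\<^sub>0 :: nat
    and V :: "nat \<Rightarrow> 'a set"
    and E :: "nat \<Rightarrow> 'a set set"
    and P :: "nat \<Rightarrow> 'a \<Rightarrow> real set"
  assumes "\<delta> > 0"
    and "graphon W"
    and "\<And>n. n \<ge> n\<^sub>0 \<Longrightarrow> simple_graph (V n) (E n)"
    and "\<And>n. n \<ge> n\<^sub>0 \<Longrightarrow> connected_graph (V n) (E n)"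
    and "\<And>n. n \<ge> n\<^sub>0 \<Longrightarrow> card (V n) = n"
    and "\<And>n v. n \<ge> n\<^sub>0 \<Longrightarrow> v \<in> V n \<Longrightarrow> real (vertex_degree (E n) v) \<ge> \<delta> * real n"
    and "\<And>n. n \<ge> n\<^sub>0 \<Longrightarrow> equipartition (V n) (P n)"
    and "(\<lambda>n. cut_distance W (graph_graphon (V n) (E n) (P n))) \<longlonglongrightarrow> 0"
  shows "(\<lambda>n. root n (real (num_spanning_trees (V n) (E n))) / real n)
           \<longlonglongrightarrow> exp (LINT x|unit_space. ln (graphon_degree W x))"
proof -
  \<comment> \<open>The added positive null sequence makes the inequality \<open>cut\<close> strict,
    as the choice of an automorphism requires.\<close>
  define e where "e n = cut_distance W (graph_graphon (V n) (E n) (P n)) + inverse (real (Suc n))" for n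
  define I where "I = (LINT x|unit_space. ln (graphon_degree W x))"
  \<comment> \<open>\<open>T\<close> is eventually the logarithm of the sequence in question and
    \<open>S\<close> the average log-degree; it remains to show that \<open>T - S\<close> and
    \<open>S - I\<close> tend to \<open>0\<close>.\<close>
  define S where "S n = (\<Sum>v\<in>V n. ln (real (vertex_degree (E n) v) / real n)) / real n" for n
  define T where "T n = ln (real (num_spanning_trees (V n) (E n))) / real n - ln (real n)" for n
  have e0: "e \<longlonglongrightarrow> 0"
    unfolding e_def using tendsto_add[OF assms(8) LIMSEQ_inverse_real_of_nat] by simp
  have deg: "\<delta> * real (card (V n)) \<le> real (vertex_degree (E n) v)" if "n \<ge> n\<^sub>0" "v \<in> V n" for n v
    using assms(6)[OF that] assms(5)[OF that(1)] by simp
  have cut: "cut_distance W (graph_graphon (V n) (E n) (P n)) < e n" for n by (simp add: e_def)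
  let ?m = "\<lambda>x. max 0 (\<delta> - graphon_degree W x)"
  \<comment> \<open>The left side does not depend on \<open>n\<close>, so letting \<open>n\<close>
    grow in the defect bound makes the defect vanish.\<close>
  have "(LINT x|unit_space. ?m x) \<le> 2 * 0"
    using graph_degree_defect_and_log(1)[OF assms(1,2,3,7) deg cut]
    by (intro LIMSEQ_le_const[OF tendsto_mult_left[OF e0]]) blast
  moreover have "0 \<le> (LINT x|unit_space. ?m x)" by (intro integral_nonneg_AE) simp
  moreover have m_int: "integrable unit_space ?m"
  proof (rule unit_integrable_bounded[of _ "\<delta> + 1"])
    show "?m \<in> borel_measurable unit_space"
      using graphon_sections(2)[OF assms(2)] by measurable
    show "\<bar>?m x\<bar> \<le> \<delta> + 1" if "x \<in> {0..1}" for x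
      using graphon_degree_le_one[OF assms(2) that] assms(1) by linarith
  qed
  ultimately have "AE x in unit_space. ?m x = 0"
    using integral_nonneg_eq_0_iff_AE[OF m_int] by simp
  hence ae: "AE x in unit_space. \<delta> \<le> graphon_degree W x" by eventually_elim linarith
  have "(\<lambda>n. S n - I) \<longlonglongrightarrow> 0"
  proof (rule Lim_null_comparison)
    show "(\<lambda>n. 2 * e n / \<delta>) \<longlonglongrightarrow> 0"
      using tendsto_divide[OF tendsto_mult_left[OF e0, of 2] tendsto_const[of \<delta>]] assms(1) by simp
    show "\<forall>\<^sub>F n in sequentially. norm (S n - I) \<le> 2 * e n / \<delta>"
      using eventually_ge_at_top[of n\<^sub>0]
    proof eventually_elim
      case (elim n)
      show ?case
        using graph_degree_defect_and_log(2)[OF assms(1,2) assms(3)[OF elim] assms(7)[OF elim]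
            deg[OF elim] cut ae]
        by (simp add: S_def I_def assms(5)[OF elim])
    qed
  qed
  moreover have "(\<lambda>n. T n - S n) \<longlonglongrightarrow> 0"
  proof (rule Lim_null_comparison)
    have "(\<lambda>n. ln 2 / real n) \<longlonglongrightarrow> 0"
      and "(\<lambda>n. (1 + ln (real n)) * ln ((real n)\<^sup>2 + 1) / real n) \<longlonglongrightarrow> 0"
      by real_asymp+
    from tendsto_add[OF this(1) tendsto_mult_left[OF this(2), of "4 / \<delta>"]]
    show "(\<lambda>n. ln 2 / real n + 4 / \<delta> * ((1 + ln (real n)) * ln ((real n)\<^sup>2 + 1) / real n)) \<longlonglongrightarrow> 0"
      by simp
    show "\<forall>\<^sub>F n in sequentially. norm (T n - S n) \<le>
        ln 2 / real n + 4 / \<delta> * ((1 + ln (real n)) * ln ((real n)\<^sup>2 + 1) / real n)"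
      using eventually_ge_at_top[of n\<^sub>0]
    proof eventually_elim
      case (elim n)
      show ?case
        using log_spanning_trees_close(2)[OF assms(3)[OF elim] assms(4)[OF elim] assms(1) deg[OF elim]]
        by (simp add: S_def T_def assms(5)[OF elim])
    qed
  qed
  ultimately have "(\<lambda>n. (T n - S n) + (S n - I)) \<longlonglongrightarrow> 0 + 0" by (intro tendsto_add)
  hence "(\<lambda>n. T n - I) \<longlonglongrightarrow> 0" by simp
  hence "T \<longlonglongrightarrow> I" by (rule LIM_zero_cancel)
  hence "(\<lambda>n. exp (T n)) \<longlonglongrightarrow> exp I" by (rule tendsto_exp)
  moreover have "\<forall>\<^sub>F n in sequentially.
      exp (T n) = root n (real (num_spanning_trees (V n) (E n))) / real n"
    using eventually_ge_at_top[of n\<^sub>0] eventually_gt_at_top[of 0]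
  proof eventually_elim
    case (elim n)
    let ?t = "real (num_spanning_trees (V n) (E n))"
    have t: "?t > 0"
      using log_spanning_trees_close(1)[OF assms(3)[OF elim(1)] assms(4)[OF elim(1)] assms(1) deg[OF elim(1)]]
      by simp
    \<comment> \<open>Here both \<open>n\<close> and the number of spanning trees must be
      positive.\<close>
    have "T n = ln (root n ?t / real n)"
      using t elim(2) by (simp add: T_def ln_div ln_root)
    thus ?case using t elim(2) by simp
  qed
  ultimately show ?thesis unfolding I_def by (rule Lim_transform_eventually)
qed

end
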